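(* Let $G$ be a $4$-edge-connected graph (multigraph; parallel edges and loops allowed) and let $r\in V(G)$. Then there exists a set of four spanning trees of $G$ that are pairwise edge-independent with root $r$.
   Context: Graphs are multigraphs: parallel edges and loops are allowed; a loop contributes $2$ to the degree of its vertex. Paths and cycles are simple. Two subtrees $T_1,T_2$ of $G$ are edge-independent with root $r$ if both contain $r$ and for every $v\in V(T_1)\cap V(T_2)$ the unique $r$–$v$ path in $T_1$ is edge-disjoint from the unique $r$–$v$ path in $T_2$. A larger set of trees is edge-independent with root $r$ if its members are pairwise edge-independent with root $r$. *)

theory Defs
  imports Main "HOL-Library.Uprod"
begin

text \<open>
  Edges have their own type, so parallel edges are distinct edges with the same ends; a loop at
  \<open>v\<close> is an edge with ends \<open>Upair v v\<close>. The values of \<open>ends\<close> outside \<open>edges\<close> are irrelevant.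
\<close>

record ('v, 'e) multigraph =
  verts :: "'v set"
  edges :: "'e set"
  ends :: "'e \<Rightarrow> 'v uprod"

definition wf_multigraph :: "('v, 'e) multigraph \<Rightarrow> bool" where
  "wf_multigraph G \<longleftrightarrow> (\<forall>e \<in> edges G. set_uprod (ends G e) \<subseteq> verts G)"

definition finite_multigraph :: "('v, 'e) multigraph \<Rightarrow> bool" where
  "finite_multigraph G \<longleftrightarrow> wf_multigraph G \<and> finite (verts G) \<and> finite (edges G)"

definition subgraph :: "('v, 'e) multigraph \<Rightarrow> ('v, 'e) multigraph \<Rightarrow> bool" where
  "subgraph H G \<longleftrightarrow>
     wf_multigraph H \<and> verts H \<subseteq> verts G \<and> edges H \<subseteq> edges G \<and> ends H = ends G"

definition delete_edges :: "('v, 'e) multigraph \<Rightarrow> 'e set \<Rightarrow> ('v, 'e) multigraph" where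
  "delete_edges G F = G\<lparr>edges := edges G - F\<rparr>"

text \<open>
  A walk from \<open>u\<close> to \<open>v\<close> is stored as the list of its steps, each step being the edge
  traversed together with the vertex reached; the start vertex \<open>u\<close> is not in the list.
\<close>

fun walk :: "('v, 'e) multigraph \<Rightarrow> 'v \<Rightarrow> ('e \<times> 'v) list \<Rightarrow> 'v \<Rightarrow> bool" where
  "walk G u [] v \<longleftrightarrow> u \<in> verts G \<and> u = v"
| "walk G u ((e, w) # p) v \<longleftrightarrow>
     u \<in> verts G \<and> e \<in> edges G \<and> ends G e = Upair u w \<and> walk G w p v"

definition walk_edges :: "('e \<times> 'v) list \<Rightarrow> 'e set" where
  "walk_edges p = fst ` set p"

definition path :: "('v, 'e) multigraph \<Rightarrow> 'v \<Rightarrow> ('e \<times> 'v) list \<Rightarrow> 'v \<Rightarrow> bool" where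
  "path G u p v \<longleftrightarrow> walk G u p v \<and> distinct (u # map snd p)"

text \<open>
  Loops and pairs of parallel edges are cycles, of length 1 and 2. Distinctness of the edges is
  needed only to exclude going back and forth along a single edge.
\<close>

definition cycle :: "('v, 'e) multigraph \<Rightarrow> 'v \<Rightarrow> ('e \<times> 'v) list \<Rightarrow> bool" where
  "cycle G u p \<longleftrightarrow>
     walk G u p u \<and> p \<noteq> [] \<and> distinct (map fst p) \<and> distinct (map snd p)"

definition connected :: "('v, 'e) multigraph \<Rightarrow> bool" where
  "connected G \<longleftrightarrow>
     verts G \<noteq> {} \<and> (\<forall>u \<in> verts G. \<forall>v \<in> verts G. \<exists>p. path G u p v)"

text \<open>
  As usual, a \<open>k\<close>-edge-connected graph has more than one vertex. (A one-vertex graph has only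
  one spanning tree.)
\<close>

definition edge_connected :: "nat \<Rightarrow> ('v, 'e) multigraph \<Rightarrow> bool" where
  "edge_connected k G \<longleftrightarrow>
     card (verts G) > 1 \<and>
     (\<forall>F. F \<subseteq> edges G \<and> finite F \<and> card F < k \<longrightarrow> connected (delete_edges G F))"

definition tree :: "('v, 'e) multigraph \<Rightarrow> bool" where
  "tree T \<longleftrightarrow> wf_multigraph T \<and> connected T \<and> \<not> (\<exists>u p. cycle T u p)"

definition subtree :: "('v, 'e) multigraph \<Rightarrow> ('v, 'e) multigraph \<Rightarrow> bool" where
  "subtree T G \<longleftrightarrow> subgraph T G \<and> tree T"

definition spanning_tree :: "('v, 'e) multigraph \<Rightarrow> ('v, 'e) multigraph \<Rightarrow> bool" where
  "spanning_tree T G \<longleftrightarrow> subtree T G \<and> verts T = verts G"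

text \<open>
  Since \<open>T1\<close> and \<open>T2\<close> are trees, the paths \<open>p\<close> and \<open>q\<close> below exist and are unique.
\<close>

definition edge_independent ::
  "('v, 'e) multigraph \<Rightarrow> 'v \<Rightarrow> ('v, 'e) multigraph \<Rightarrow> ('v, 'e) multigraph \<Rightarrow> bool" where
  "edge_independent G r T1 T2 \<longleftrightarrow>
     subtree T1 G \<and> subtree T2 G \<and> r \<in> verts T1 \<and> r \<in> verts T2 \<and>
     (\<forall>v \<in> verts T1 \<inter> verts T2. \<forall>p q.
        path T1 r p v \<and> path T2 r q v \<longrightarrow> walk_edges p \<inter> walk_edges q = {})"

definition edge_independent_set ::
  "('v, 'e) multigraph \<Rightarrow> 'v \<Rightarrow> ('v, 'e) multigraph set \<Rightarrow> bool" where
  "edge_independent_set G r \<T> \<longleftrightarrow> pairwise (edge_independent G r) \<T>"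

end

theory Submission
  imports Defs "HOL.Rat" "HOL-Library.Multiset"
begin

text \<open>
  Call a list of all edges valid if for every vertex \<open>v\<close> it splits into a prefix and a suffix such
  that \<open>v\<close> has two edge-disjoint paths to \<open>r\<close> in either part. Growing ears along the list, with a
  numbering in the style of st-numberings, yields two trees with edge-disjoint root paths that
  moreover stay inside each prefix in which \<open>v\<close> is doubly connected to \<open>r\<close>. The reversed list
  yields two more trees, and these stay inside the complementary suffix.

  Valid lists exist by induction on the number of edges. If no edge can be deleted, then there is
  a vertex \<open>v \<noteq> r\<close> of degree four, and its edges can be split off in pairs. In a valid list of the
  smaller graph the two new edges \<open>e\<close> and \<open>f\<close> are moved towards each other. Either they get stuck;
  then the ends of \<open>e\<close> are doubly connected to \<open>r\<close> up to \<open>e\<close> and those of \<open>f\<close> from \<open>f\<close> on, so that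
  \<open>e\<close> and \<open>f\<close> can simply be subdivided. Or they become adjacent; then this pair can be shifted to a
  place where matroid partition assigns two of the four edges at \<open>v\<close> to the prefix and the other
  two to the suffix.
\<close>

section \<open>Cuts and valid edge lists\<close>

text \<open>Double connection to \<open>r\<close> is expressed by cut sizes, so that every step
  becomes an uncrossing of vertex sets and no system of paths has to be rerouted. The obstacle is
  the vertex \<open>v\<close> that the induction brings back: both halves of the list must connect
  it doubly to \<open>r\<close>, though the list of the smaller graph knows nothing of
  \<open>v\<close>. What helps is \<open>ends_in_biconn\<close>: an edge whose addition makes any
  new vertex doubly connected has both its own ends doubly connected afterwards. Thus an edge that
  cannot be moved reveals its ends as well connected, which is just what subdividing it by
  \<open>v\<close> requires.

  The trees only have to be edge-independent, so an ear may return to the vertex at which it starts.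
  A single number per vertex, as in an st-numbering, leaves no room for such an ear; therefore each
  vertex carries an interval from \<open>lo\<close> to \<open>hi\<close>, and the ear is fitted
  between the lower end of one attachment and the upper end of the other.\<close>

definition crosses :: "'v set \<Rightarrow> 'v uprod \<Rightarrow> bool" where
  "crosses X p \<longleftrightarrow> set_uprod p \<inter> X \<noteq> {} \<and> \<not> set_uprod p \<subseteq> X"

lemma crosses_Upair [simp]: "crosses X (Upair a b) \<longleftrightarrow> (a \<in> X) \<noteq> (b \<in> X)"
  by (auto simp: crosses_def)

definition cut_size :: "('e \<Rightarrow> 'v uprod) \<Rightarrow> 'e set \<Rightarrow> 'v set \<Rightarrow> nat" where
  "cut_size en F X = card {e \<in> F. crosses X (en e)}"

lemma cut_size_sum:
  "finite F \<Longrightarrow> cut_size en F X = (\<Sum>e\<in>F. of_bool (crosses X (en e)))"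
  by (simp add: cut_size_def Int_def)

lemma cut_size_insert:
  "finite F \<Longrightarrow> e \<notin> F \<Longrightarrow>
    cut_size en (insert e F) X = of_bool (crosses X (en e)) + cut_size en F X"
  by (simp add: cut_size_sum)

lemma cut_size_mono: "finite F' \<Longrightarrow> F \<subseteq> F' \<Longrightarrow> cut_size en F X \<le> cut_size en F' X"
  unfolding cut_size_def by (rule card_mono) auto

lemma cut_size_cong:
  "(\<And>e. e \<in> F \<Longrightarrow> crosses X (en e) = crosses Y (en' e)) \<Longrightarrow> cut_size en F X = cut_size en' F Y"
  unfolding cut_size_def by (rule arg_cong[where f=card]) auto

lemma cut_size_empty [simp]: "cut_size en F {} = 0"
  by (simp add: cut_size_def crosses_def)

lemma cut_size_submodular:
  assumes "finite F"
  shows "cut_size en F (X \<inter> Y) + cut_size en F (X \<union> Y) \<le> cut_size en F X + cut_size en F Y"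
proof -
  have "of_bool (crosses (X \<inter> Y) p) + of_bool (crosses (X \<union> Y) p)
      \<le> (of_bool (crosses X p) + of_bool (crosses Y p) :: nat)" for p
    by (cases p) auto
  then show ?thesis
    unfolding cut_size_sum[OF assms] sum.distrib[symmetric] by (intro sum_mono)
qed

lemma cut_size_posimodular:
  assumes "finite F"
  shows "cut_size en F (X - Y) + cut_size en F (Y - X) \<le> cut_size en F X + cut_size en F Y"
proof -
  have "of_bool (crosses (X - Y) p) + of_bool (crosses (Y - X) p)
      \<le> (of_bool (crosses X p) + of_bool (crosses Y p) :: nat)" for p
    by (cases p) auto
  then show ?thesis
    unfolding cut_size_sum[OF assms] sum.distrib[symmetric] by (intro sum_mono)
qed

lemma cut_size_subadditive:
  assumes "finite F"
  shows "cut_size en F X \<le> cut_size en F (X \<inter> Y) + cut_size en F (X - Y)"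
proof -
  have "of_bool (crosses X p) \<le> (of_bool (crosses (X \<inter> Y) p) + of_bool (crosses (X - Y) p) :: nat)" for p
    by (cases p) auto
  then show ?thesis
    unfolding cut_size_sum[OF assms] sum.distrib[symmetric] by (intro sum_mono)
qed

text \<open>\<open>X \<inter> Y\<close>, \<open>X - Y\<close> and the complement of \<open>X\<close>
  partition all vertices, and an edge crosses either none or exactly two of the three parts.\<close>

lemma even_cut_sizes:
  assumes "finite F"
  shows "even (cut_size en F (X \<inter> Y) + cut_size en F (X - Y) + cut_size en F X)"
proof -
  have "even (of_bool (crosses (X \<inter> Y) p) + of_bool (crosses (X - Y) p) + of_bool (crosses X p) :: nat)" for p
    by (cases p) auto
  then show ?thesis
    unfolding cut_size_sum[OF assms] sum.distrib[symmetric] by (intro dvd_sum)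
qed

section \<open>Double connection to the root\<close>

text \<open>
  By Menger's theorem these are the vertices with two edge-disjoint paths to \<open>r\<close> in \<open>F\<close>.
\<close>

definition biconn :: "'v \<Rightarrow> ('e \<Rightarrow> 'v uprod) \<Rightarrow> 'e set \<Rightarrow> 'v set" where
  "biconn r en F = {u. \<forall>X. u \<in> X \<longrightarrow> r \<notin> X \<longrightarrow> 2 \<le> cut_size en F X}"

lemma biconnD: "u \<in> biconn r en F \<Longrightarrow> u \<in> X \<Longrightarrow> r \<notin> X \<Longrightarrow> 2 \<le> cut_size en F X"
  by (simp add: biconn_def)

lemma root_in_biconn: "r \<in> biconn r en F"
  by (simp add: biconn_def)

lemma biconn_monoD:
  "u \<in> biconn r en F \<Longrightarrow> F \<subseteq> F' \<Longrightarrow> finite F' \<Longrightarrow> u \<in> biconn r en F'"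
  unfolding biconn_def by (auto intro: order_trans[OF _ cut_size_mono])

lemma biconn_mono: "finite F' \<Longrightarrow> F \<subseteq> F' \<Longrightarrow> biconn r en F \<subseteq> biconn r en F'"
  by (blast intro: biconn_monoD)

lemma biconn_cong:
  assumes "\<And>e. e \<in> F \<Longrightarrow> en e = en' e"
  shows "biconn r en F = biconn r en' F"
proof -
  have "cut_size en F X = cut_size en' F X" for X
    using assms by (intro cut_size_cong) simp
  then show ?thesis by (simp add: biconn_def)
qed

text \<open>In terms of paths: a pair of paths that is new for \<open>u\<close> must pass through
  \<open>e\<close>. The proof uncrosses a set \<open>X\<close> that is deficient for
  \<open>u\<close> without \<open>e\<close> with a set \<open>Y\<close> that is deficient for an end
  \<open>x\<close> of \<open>e\<close>.\<close>

lemma ends_in_biconn: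
  assumes fin: "finite F" and u: "u \<in> biconn r en (insert e F)" "u \<notin> biconn r en F"
  shows "set_uprod (en e) \<subseteq> biconn r en (insert e F)"
proof (rule ccontr)
  assume "\<not> ?thesis"
  then obtain x where x: "x \<in> set_uprod (en e)" "x \<notin> biconn r en (insert e F)" by blast
  then obtain y where en: "en e = Upair x y" by (cases "en e") (auto simp: Upair_inject)
  let ?F = "insert e F"
  let ?d = "cut_size en ?F" and ?c = "cut_size en F"
  have "e \<notin> F" using u by (auto simp: insert_absorb)
  note ins = cut_size_insert[OF fin this, of en]
  have finF: "finite ?F" using fin by simp
  from x(2) obtain Y where Y: "x \<in> Y" "r \<notin> Y" "?d Y \<le> 1"
    by (force simp: biconn_def)
  from u(2) obtain X where X: "u \<in> X" "r \<notin> X" "?c X \<le> 1"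
    by (force simp: biconn_def)
  have big: "2 \<le> ?d Z" if "u \<in> Z" "r \<notin> Z" for Z using u(1) that by (rule biconnD)
  have uY: "u \<notin> Y" using big[of Y] Y by auto
  have eX: "(x \<in> X) \<noteq> (y \<in> X)" using big[OF X(1,2)] X(3) ins[of X] by (auto simp: en split: split_of_bool_asm)
  have dX: "?d X = 2" using big[OF X(1,2)] X(3) ins[of X] by (auto simp: en split: split_of_bool_asm)
  have "2 \<le> ?d (X - Y)" "2 \<le> ?d (X \<union> Y)" using X Y uY by (auto intro: big)
  note b = this
  note sub = cut_size_submodular[OF finF, of en X Y] cut_size_posimodular[OF finF, of en X Y]
  show False
  proof (cases "y \<in> Y")
    case True
    \<comment> \<open>Here \<open>e\<close> lies inside \<open>Y\<close> and joins
      \<open>Y \<inter> X\<close> to \<open>Y - X\<close>. Both parts have cut size at most one and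
      spend it on \<open>e\<close>, so nothing leaves \<open>Y\<close>; uncrossing again with this
      better bound leaves no room for \<open>e\<close>.\<close>
    have "?c (Y \<inter> X) = 0" "?c (Y - X) = 0"
      using sub b dX Y eX True ins[of "Y \<inter> X"] ins[of "Y - X"] by (auto simp: en Int_commute)
    then have "?c Y = 0" using cut_size_subadditive[OF fin, of en Y X] by simp
    then have "?d Y = 0" using ins[of Y] True Y(1) by (simp add: en)
    moreover have "1 \<le> ?d (Y - X) \<or> 1 \<le> ?d (Y \<inter> X)"
      using ins[of "Y - X"] eX True Y(1) by (auto simp: en)
    ultimately show False using sub b dX eX True Y(1) ins[of "Y - X"] by (auto simp: en)
  next
    case False
    \<comment> \<open>Now no edge but \<open>e\<close> leaves \<open>Y\<close>. One of
      \<open>X - Y\<close> and \<open>X \<union> Y\<close> is not crossed by \<open>e\<close> and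
      keeps cut size at most one, although it contains \<open>u\<close>.\<close>
    then have c0: "?c Y = 0" using Y ins[of Y] by (simp add: en)
    have "?c (X - Y) \<le> 1" "?c (X \<union> Y) \<le> 1"
      using cut_size_posimodular[OF fin, of en X Y] cut_size_submodular[OF fin, of en X Y] c0 X(3)
      by linarith+
    then show False using b ins[of "X - Y"] ins[of "X \<union> Y"] False Y(1) eX by (auto simp: en split: split_of_bool_asm)
  qed
qed

section \<open>Moving two edges of a valid list towards each other\<close>

definition valid :: "'v \<Rightarrow> ('e \<Rightarrow> 'v uprod) \<Rightarrow> 'v set \<Rightarrow> 'e list \<Rightarrow> bool" where
  "valid r en V es \<longleftrightarrow>
     (\<forall>u\<in>V. \<exists>as bs. es = as @ bs \<and> u \<in> biconn r en (set as) \<and> u \<in> biconn r en (set bs))"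

lemma split_at_pair:
  assumes "as @ bs = xs @ a # b # zs"
  obtains (left) us where "xs = as @ us" "bs = us @ a # b # zs"
  | (mid) "as = xs @ [a]" "bs = b # zs"
  | (right) us where "as = xs @ a # b # us" "zs = us @ bs"
  using assms by (fastforce simp: append_eq_append_conv2 append_eq_Cons_conv)

text \<open>The swap affects only the split between the two edges, so some \<open>u\<close> depends
  on that split. The splits before and after the pair survive the swap and must fail for
  \<open>u\<close>, which makes \<open>ends_in_biconn\<close> applicable to \<open>a\<close> and to
  \<open>b\<close>.\<close>

lemma swap_invalid:
  assumes val: "valid r en V (xs @ a # b # zs)" and inval: "\<not> valid r en V (xs @ b # a # zs)"
  obtains u where "u \<in> biconn r en (insert a (set xs))" "u \<notin> biconn r en (set xs)"
    "u \<in> biconn r en (insert b (set zs))" "u \<notin> biconn r en (set zs)"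
proof -
  let ?C = "biconn r en"
  from inval obtain u where u: "u \<in> V"
    "\<And>as bs. xs @ b # a # zs = as @ bs \<Longrightarrow> u \<in> ?C (set as) \<Longrightarrow> u \<notin> ?C (set bs)"
    unfolding valid_def by blast
  from val u(1) obtain as bs where split: "as @ bs = xs @ a # b # zs"
    and m: "u \<in> ?C (set as)" "u \<in> ?C (set bs)"
    unfolding valid_def by metis
  from split show ?thesis
  proof (cases rule: split_at_pair)
    case (left us)
    then show ?thesis using u(2)[of as "us @ b # a # zs"] m by (auto simp: insert_commute)
  next
    case (right us)
    then show ?thesis using u(2)[of "xs @ b # a # us" bs] m by (auto simp: insert_commute)
  next
    case mid
    have "u \<in> ?C (set (b # a # zs))" "u \<in> ?C (set (xs @ [b, a]))"
      using m mid biconn_mono[of "set (b # a # zs)" "set bs" r en]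
        biconn_mono[of "set (xs @ [b, a])" "set as" r en] by auto
    then have "u \<notin> ?C (set xs)" "u \<notin> ?C (set zs)"
      using u(2)[of xs "b # a # zs"] u(2)[of "xs @ [b, a]" zs] by auto
    then show ?thesis using that m mid by simp
  qed
qed

text \<open>
  The edges \<open>e\<close> and \<open>f\<close> stand side by side, and no vertex needs the split between them.
\<close>

definition flanked ::
  "'v \<Rightarrow> ('e \<Rightarrow> 'v uprod) \<Rightarrow> 'v set \<Rightarrow> 'e list \<Rightarrow> 'e \<Rightarrow> 'e \<Rightarrow> 'e list \<Rightarrow> bool" where
  "flanked r en V xs e f zs \<longleftrightarrow>
     (\<forall>u\<in>V. (\<exists>as us. xs = as @ us \<and> u \<in> biconn r en (set as) \<and> u \<in> biconn r en (set (us @ e # f # zs)))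
          \<or> (\<exists>us bs. zs = us @ bs \<and> u \<in> biconn r en (set (xs @ e # f # us)) \<and> u \<in> biconn r en (set bs)))"

text \<open>A vertex that depends on the split between \<open>e\<close> and \<open>f\<close> is
  completed by \<open>e\<close> in the prefix and by \<open>f\<close> in the suffix, so
  \<open>ends_in_biconn\<close> applies on both sides.\<close>

lemma flanked_or_separated:
  assumes val: "valid r en V (xs @ e # f # zs)" and nf: "\<not> flanked r en V xs e f zs"
  shows "set_uprod (en e) \<subseteq> biconn r en (insert e (set xs))
    \<and> set_uprod (en f) \<subseteq> biconn r en (insert f (set zs))"
proof -
  let ?C = "biconn r en"
  from nf obtain u where u: "u \<in> V"
    "\<And>as us. xs = as @ us \<Longrightarrow> u \<in> ?C (set as) \<Longrightarrow> u \<notin> ?C (set (us @ e # f # zs))"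
    "\<And>us bs. zs = us @ bs \<Longrightarrow> u \<in> ?C (set (xs @ e # f # us)) \<Longrightarrow> u \<notin> ?C (set bs)"
    unfolding flanked_def by blast
  from val u(1) obtain as bs where split: "as @ bs = xs @ e # f # zs"
    and m: "u \<in> ?C (set as)" "u \<in> ?C (set bs)"
    unfolding valid_def by metis
  from split show ?thesis
  proof (cases rule: split_at_pair)
    case (left us)
    then show ?thesis using u(2) m by metis
  next
    case (right us)
    then show ?thesis using u(3) m by metis
  next
    case mid
    have "u \<in> ?C (set (e # f # zs))" "u \<in> ?C (set (xs @ [e, f]))"
      using m mid biconn_mono[of "set (e # f # zs)" "set bs" r en]
        biconn_mono[of "set (xs @ [e, f])" "set as" r en] by auto
    then have "u \<notin> ?C (set xs)" "u \<notin> ?C (set zs)"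
      using u(2)[of xs "[]"] u(3)[of "[]" zs] by auto
    then show ?thesis
      using ends_in_biconn[of "set xs" u r en e] ends_in_biconn[of "set zs" u r en f] m mid by simp
  qed
qed

text \<open>The distance between \<open>e\<close> and \<open>f\<close> shrinks as long as one of
  them can be swapped inwards. If both swaps fail, one failure yields the conclusion on
  \<open>e\<close> and the other the conclusion on \<open>f\<close>; the edges in between do not
  matter.\<close>

lemma pull_together:
  assumes "valid r en V (xs @ e # ys @ f # zs)"
  shows "(\<exists>xs' ys' zs'. valid r en V (xs' @ e # ys' @ f # zs')
            \<and> mset (xs' @ e # ys' @ f # zs') = mset (xs @ e # ys @ f # zs)
            \<and> set_uprod (en e) \<subseteq> biconn r en (insert e (set xs'))
            \<and> set_uprod (en f) \<subseteq> biconn r en (insert f (set zs')))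
       \<or> (\<exists>xs' zs'. flanked r en V xs' e f zs' \<and> mset (xs' @ zs') = mset (xs @ ys @ zs))"
  using assms
proof (induction "length ys" arbitrary: xs ys zs)
  case 0
  then have ys: "ys = []" and val: "valid r en V (xs @ e # f # zs)" by simp_all
  then show ?case using flanked_or_separated[OF val] by (metis append_Nil)
next
  case (Suc n)
  then obtain g ys1 where ys1: "ys = g # ys1" by (cases ys) auto
  from Suc obtain ys2 h where ys2: "ys = ys2 @ [h]" by (cases ys rule: rev_cases) auto
  show ?case
  proof (cases "valid r en V ((xs @ [g]) @ e # ys1 @ f # zs)")
    case True
    from Suc(1)[OF _ this] show ?thesis using Suc(2) ys1 by (simp add: ac_simps)
  next
    case False
    show ?thesis
    proof (cases "valid r en V (xs @ e # ys2 @ f # h # zs)")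
      case True
      from Suc(1)[OF _ this] show ?thesis using Suc(2) ys2 by (simp add: ac_simps)
    next
      case F2: False
      have *: "valid r en V (xs @ e # g # ys1 @ f # zs)"
        using Suc(3) ys1 by simp
      have **: "valid r en V ((xs @ e # ys2) @ h # f # zs)"
        using Suc(3) ys2 by simp
      have "\<not> valid r en V (xs @ g # e # ys1 @ f # zs)"
        "\<not> valid r en V ((xs @ e # ys2) @ f # h # zs)"
        using False F2 by simp_all
      note inval = this
      obtain u where "u \<in> biconn r en (insert e (set xs))" "u \<notin> biconn r en (set xs)"
        by (rule swap_invalid[OF * inval(1)])
      then have "set_uprod (en e) \<subseteq> biconn r en (insert e (set xs))"
        by (intro ends_in_biconn) auto
      moreover obtain u' where "u' \<in> biconn r en (insert f (set zs))" "u' \<notin> biconn r en (set zs)"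
        by (rule swap_invalid[OF ** inval(2)])
      then have "set_uprod (en f) \<subseteq> biconn r en (insert f (set zs))"
        by (intro ends_in_biconn) auto
      ultimately show ?thesis using Suc(3) by blast
    qed
  qed
qed

text \<open>The pair itself needs no reversal, since only the set of edges on either side of a split
  matters.\<close>

lemma flanked_rev: "flanked r en V xs e f zs \<Longrightarrow> flanked r en V (rev zs) e f (rev xs)"
  unfolding flanked_def
proof (intro ballI, goal_cases)
  case (1 u)
  then consider as us where "xs = as @ us" "u \<in> biconn r en (set as)" "u \<in> biconn r en (set (us @ e # f # zs))"
    | us bs where "zs = us @ bs" "u \<in> biconn r en (set (xs @ e # f # us))" "u \<in> biconn r en (set bs)"
    by blast
  then show ?case
  proof cases
    case 1
    then have "rev xs = rev us @ rev as \<and> u \<in> biconn r en (set (rev zs @ e # f # rev us)) \<and>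
       u \<in> biconn r en (set (rev as))" by (simp add: Un_commute)
    then show ?thesis by blast
  next
    case 2
    then have "rev zs = rev bs @ rev us \<and> u \<in> biconn r en (set (rev bs)) \<and>
       u \<in> biconn r en (set (rev us @ e # f # rev xs))" by (simp add: Un_commute)
    then show ?thesis by blast
  qed
qed

section \<open>Linkage on both sides of an adjacent pair\<close>

text \<open>
  In Menger's dual form: two of the four vertices have edge-disjoint paths to \<open>r\<close> in \<open>F\<close>.
\<close>

definition linked :: "'v \<Rightarrow> ('e \<Rightarrow> 'v uprod) \<Rightarrow> 'e set \<Rightarrow> 'v \<Rightarrow> 'v \<Rightarrow> 'v \<Rightarrow> 'v \<Rightarrow> bool" where
  "linked r en F x y z w \<longleftrightarrow>
     (\<forall>Y. r \<notin> Y \<longrightarrow> 2 \<le> cut_size en F Y + of_bool (x \<notin> Y) + of_bool (y \<notin> Y) + of_bool (z \<notin> Y) + of_bool (w \<notin> Y))"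

text \<open>A set \<open>Y\<close> refuting the linkage contains at least three of the four ends,
  and none of its vertices is doubly connected in the prefix, even with \<open>e\<close> and
  \<open>f\<close> added. Hence the ends in \<open>Y\<close> are served far to the right, which
  links the remaining suffix and makes moving the pair harmless.\<close>

lemma flanked_shift:
  assumes fl: "flanked r en V xs e f zs" and nl: "\<not> linked r en (set xs) x y z w"
    and en: "en e = Upair x y" "en f = Upair z w" and V: "{x, y, z, w} \<subseteq> V"
    and d: "e \<noteq> f" "e \<notin> set xs" "f \<notin> set xs"
  obtains g zs' where "zs = g # zs'" "flanked r en V (xs @ [g]) e f zs'" "linked r en (set zs') x y z w"
proof -
  let ?C = "biconn r en"
  let ?F = "insert e (insert f (set xs))"
  from nl obtain Y where Y: "r \<notin> Y" "cut_size en (set xs) Y + of_bool (x \<notin> Y) + of_bool (y \<notin> Y)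
      + of_bool (z \<notin> Y) + of_bool (w \<notin> Y) \<le> 1"
    by (auto simp: linked_def not_le)
  \<comment> \<open>If \<open>e\<close> or \<open>f\<close> crosses \<open>Y\<close>, it has an end
    outside \<open>Y\<close>, which the violated inequality already counts.\<close>
  have "cut_size en ?F Y \<le> 1" using Y(2) d by (auto simp: cut_size_insert en split: split_of_bool_asm)
  then have out: "Y \<inter> ?C ?F = {}" using Y(1) by (force dest: biconnD)
  have xy: "x \<in> Y \<or> y \<in> Y" and zw: "z \<in> Y \<or> w \<in> Y" using Y(2) by (auto split: split_of_bool_asm)
  have sub1: "?C (set xs) \<subseteq> ?C (insert f (set xs))" "?C (insert f (set xs)) \<subseteq> ?C ?F"
    by (rule biconn_mono; auto)+
  \<comment> \<open>An edge whose addition enlarged \<open>?C\<close> would have both ends in it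
    afterwards, but \<open>e\<close> and \<open>f\<close> each have an end in
    \<open>Y\<close>.\<close>
  have eqC: "?C ?F = ?C (set xs)"
  proof -
    have "?C (insert f (set xs)) = ?C ?F"
      using ends_in_biconn[of "insert f (set xs)" _ r en e] sub1 xy out by (auto simp: en)
    moreover have "?C (set xs) = ?C (insert f (set xs))"
      using ends_in_biconn[of "set xs" _ r en f] sub1 zw out by (auto simp: en)
    ultimately show ?thesis by simp
  qed
  have right: "\<exists>g us bs. zs = g # us @ bs \<and> u \<in> ?C (set bs)" if u: "u \<in> V" "u \<in> Y" for u
  proof -
    have nu: "u \<notin> ?C ?F" using out u by blast
    moreover have "u \<in> ?C ?F" if "xs = as @ us" "u \<in> ?C (set as)" for as us
      using that(2) by (rule biconn_monoD) (use that(1) in auto)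
    moreover from fl u(1) consider as us where "xs = as @ us" "u \<in> ?C (set as)"
      | us bs where "zs = us @ bs" "u \<in> ?C (set (xs @ e # f # us))" "u \<in> ?C (set bs)"
      unfolding flanked_def by metis
    ultimately obtain us bs where us: "zs = us @ bs" "u \<in> ?C (set (xs @ e # f # us))" "u \<in> ?C (set bs)"
      by metis
    have "us \<noteq> []" using nu us(2) by (auto simp: insert_commute)
    then show ?thesis using us by (cases us) auto
  qed
  obtain g zs' where zs: "zs = g # zs'" using right[of x] right[of y] xy V by auto
  have in_zs': "u \<in> ?C (set zs')" if u: "u \<in> {x, y, z, w}" "u \<in> Y" for u
  proof -
    obtain g us bs where "zs = g # us @ bs" "u \<in> ?C (set bs)" using right[of u] u V by blast
    then show ?thesis using biconn_monoD[of u r en "set bs" "set zs'"] zs by auto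
  qed
  have "linked r en (set zs') x y z w"
    unfolding linked_def
  proof (intro allI impI, rule ccontr)
    fix Y' assume Y': "r \<notin> Y'" and small: "\<not> 2 \<le> cut_size en (set zs') Y' + of_bool (x \<notin> Y') + of_bool (y \<notin> Y')
      + of_bool (z \<notin> Y') + of_bool (w \<notin> Y')"
    \<comment> \<open>Each of the two sets misses at most one of the four ends.\<close>
    have "\<exists>u\<in>{x, y, z, w}. u \<in> Y \<and> u \<in> Y'"
    proof (rule ccontr)
      assume "\<not> ?thesis"
      then have *: "(1::nat) \<le> of_bool (u \<notin> Y) + of_bool (u \<notin> Y')" if "u \<in> {x, y, z, w}" for u
        using that by auto
      show False using *[of x] *[of y] *[of z] *[of w] small Y(2) by simp
    qed
    then obtain u where "u \<in> {x, y, z, w}" "u \<in> Y" "u \<in> Y'" by blast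
    then have "2 \<le> cut_size en (set zs') Y'" using in_zs' biconnD Y' by metis
    then show False using small by linarith
  qed
  moreover have "flanked r en V (xs @ [g]) e f zs'"
    unfolding flanked_def
  proof
    fix u assume "u \<in> V"
    with fl consider as us where "xs = as @ us" "u \<in> ?C (set as)" "u \<in> ?C (set (us @ e # f # zs))"
      | us bs where "zs = us @ bs" "u \<in> ?C (set (xs @ e # f # us))" "u \<in> ?C (set bs)"
      unfolding flanked_def by blast
    then show "(\<exists>as us. xs @ [g] = as @ us \<and> u \<in> ?C (set as) \<and> u \<in> ?C (set (us @ e # f # zs')))
          \<or> (\<exists>us bs. zs' = us @ bs \<and> u \<in> ?C (set ((xs @ [g]) @ e # f # us)) \<and> u \<in> ?C (set bs))"
    proof cases
      case 1
      then have "xs @ [g] = as @ us @ [g] \<and> u \<in> ?C (set as) \<and> u \<in> ?C (set ((us @ [g]) @ e # f # zs'))"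
        using zs by (simp add: insert_commute)
      then show ?thesis by blast
    next
      case 2
      show ?thesis
      proof (cases us)
        case Nil
        \<comment> \<open>The split directly behind \<open>f\<close> is the only one destroyed by
          the move. By \<open>eqC\<close> the prefix did not need the pair, so the split can be
          placed before \<open>g\<close>.\<close>
        then have "u \<in> ?C (set xs)" using 2 eqC by (simp add: insert_commute)
        moreover have "u \<in> ?C (set ([g] @ e # f # zs'))"
          by (rule biconn_monoD[OF 2(3)]) (use 2(1) Nil zs in auto)
        ultimately show ?thesis by blast
      next
        case (Cons g' us')
        then have "zs' = us' @ bs \<and> u \<in> ?C (set ((xs @ [g]) @ e # f # us')) \<and> u \<in> ?C (set bs)"
          using 2 zs by (simp add: insert_commute)
        then show ?thesis by blast
      qed
    qed
  qed
  ultimately show ?thesis using that zs by blast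
qed

text \<open>While the prefix is not linked the pair moves right. \<open>flanked_shift\<close> keeps
  the suffix linked at every move and rules out that the suffix runs empty first.\<close>

lemma flanked_linked_right:
  assumes "flanked r en V xs e f zs" "linked r en (set zs) x y z w"
    and en: "en e = Upair x y" "en f = Upair z w" and V: "{x, y, z, w} \<subseteq> V"
    and "distinct (xs @ e # f # zs)"
  shows "\<exists>xs' zs'. flanked r en V xs' e f zs' \<and> mset (xs' @ zs') = mset (xs @ zs)
     \<and> linked r en (set xs') x y z w \<and> linked r en (set zs') x y z w"
  using assms(1,2,6)
proof (induction zs arbitrary: xs)
  case Nil
  have "linked r en (set xs) x y z w"
  proof (rule ccontr)
    assume "\<not> ?thesis"
    from flanked_shift[OF Nil(1) this en V] show False using Nil(3) by auto
  qed
  then show ?case using Nil by blast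
next
  case (Cons g zs)
  show ?case
  proof (cases "linked r en (set xs) x y z w")
    case False
    have "e \<noteq> f" "e \<notin> set xs" "f \<notin> set xs" using Cons(4) by auto
    from flanked_shift[OF Cons(2) False en V this]
    have "flanked r en V (xs @ [g]) e f zs" "linked r en (set zs) x y z w" by auto
    then show ?thesis using Cons(1)[of "xs @ [g]"] Cons(4) by auto
  qed (use Cons in blast)
qed

text \<open>If the suffix is not linked, one shift in the reversed list shows that what remains on
  the other side is linked, and the pair then only has to travel in that direction.\<close>

lemma flanked_linked:
  assumes fl: "flanked r en V xs e f zs"
    and en: "en e = Upair x y" "en f = Upair z w" and V: "{x, y, z, w} \<subseteq> V"
    and dist: "distinct (xs @ e # f # zs)"
  obtains xs' zs' where "flanked r en V xs' e f zs'" "mset (xs' @ zs') = mset (xs @ zs)"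
     "linked r en (set xs') x y z w" "linked r en (set zs') x y z w"
proof (cases "linked r en (set zs) x y z w")
  case True
  then show ?thesis using flanked_linked_right[OF fl _ en V dist] that by blast
next
  case False
  have d: "distinct (rev zs @ e # f # rev xs)" using dist by auto
  have nl: "\<not> linked r en (set (rev zs)) x y z w" using False by simp
  have e: "e \<noteq> f" "e \<notin> set (rev zs)" "f \<notin> set (rev zs)" using dist by auto
  obtain g zs' where g: "rev xs = g # zs'" "flanked r en V (rev zs @ [g]) e f zs'"
    "linked r en (set zs') x y z w"
    by (rule flanked_shift[OF flanked_rev[OF fl] nl en V e])
  have "distinct ((rev zs @ [g]) @ e # f # zs')" using d g by auto
  from flanked_linked_right[OF g(2,3) en V this] obtain xs2 zs2 where
    *: "flanked r en V xs2 e f zs2" "mset (xs2 @ zs2) = mset ((rev zs @ [g]) @ zs')"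
     "linked r en (set xs2) x y z w" "linked r en (set zs2) x y z w" by blast
  have "mset ((rev zs @ [g]) @ zs') = mset (rev xs) + mset zs" using g by simp
  then show ?thesis using that[OF flanked_rev[OF *(1)]] * by (simp add: ac_simps)
qed

section \<open>Pinching a pair of edges\<close>

text \<open>Indices instead of vertices, because parallel edges at \<open>v\<close> have equal far
  ends that must count separately. By Menger's theorem a finite \<open>S\<close> is joined iff two
  of its members have edge-disjoint paths to \<open>r\<close> in \<open>F\<close>.\<close>

definition joined ::
  "'v \<Rightarrow> ('e \<Rightarrow> 'v uprod) \<Rightarrow> 'e set \<Rightarrow> ('i \<Rightarrow> 'v) \<Rightarrow> 'i set \<Rightarrow> bool" where
  "joined r en F \<sigma> S \<longleftrightarrow> (\<forall>Y. r \<notin> Y \<longrightarrow> 2 \<le> cut_size en F Y + card {i \<in> S. \<sigma> i \<notin> Y})"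

lemma biconn_attach:
  assumes "finite F" "finite T" "F \<inter> T = {}" "\<And>i. i \<in> T \<Longrightarrow> en i = Upair v (\<sigma> i)"
    and "joined r en F \<sigma> T"
  shows "v \<in> biconn r en (F \<union> T)"
  unfolding biconn_def
proof (intro CollectI allI impI)
  fix X assume X: "v \<in> X" "r \<notin> X"
  have "{e \<in> F \<union> T. crosses X (en e)} = {e \<in> F. crosses X (en e)} \<union> {i \<in> T. \<sigma> i \<notin> X}"
    using X assms(4) by (auto simp: assms(4))
  also have "card \<dots> = cut_size en F X + card {i \<in> T. \<sigma> i \<notin> X}"
    unfolding cut_size_def by (rule card_Un_disjoint) (use assms(1-3) in auto)
  finally show "2 \<le> cut_size en (F \<union> T) X"
    using assms(5) X(2) unfolding joined_def cut_size_def by simp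
qed

lemma joined_biconn:
  assumes "card T = 2" "\<And>i. i \<in> T \<Longrightarrow> \<sigma> i \<in> biconn r en F"
  shows "joined r en F \<sigma> T"
  unfolding joined_def
proof (intro allI impI)
  fix Y assume "r \<notin> Y"
  show "2 \<le> cut_size en F Y + card {i \<in> T. \<sigma> i \<notin> Y}"
  proof (cases "\<exists>i\<in>T. \<sigma> i \<in> Y")
    case True
    then show ?thesis using assms(2) biconnD \<open>r \<notin> Y\<close> by (metis trans_le_add1)
  next
    case False
    then have "{i \<in> T. \<sigma> i \<notin> Y} = T" by auto
    then show ?thesis using assms(1) by simp
  qed
qed

text \<open>
  If no pair containing \<open>i\<close> were joined, the union of the violating sets would violate the
  condition for \<open>S\<close>.
\<close>

lemma joined_pair_exists:
  assumes F: "finite F" and S: "finite S" "i \<in> S" "joined r en F \<sigma> S"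
    and conn: "\<And>Y. r \<notin> Y \<Longrightarrow> \<sigma> i \<in> Y \<Longrightarrow> 1 \<le> cut_size en F Y"
  obtains j where "j \<in> S" "j \<noteq> i" "joined r en F \<sigma> {i, j}"
proof (rule ccontr)
  assume "\<not> thesis"
  with that have no: "\<not> joined r en F \<sigma> {i, j}" if "j \<in> S" "j \<noteq> i" for j using that by blast
  have "\<exists>Y. r \<notin> Y \<and> \<sigma> ` J \<subseteq> Y \<and> cut_size en F Y + of_bool (\<sigma> i \<notin> Y) \<le> 1"
    if "finite J" "J \<subseteq> S - {i}" for J
    using that
  proof (induction J rule: finite_induct)
    case empty
    show ?case by (intro exI[of _ "{}"]) simp
  next
    case (insert j J)
    then obtain Y where Y: "r \<notin> Y" "\<sigma> ` J \<subseteq> Y" "cut_size en F Y + of_bool (\<sigma> i \<notin> Y) \<le> 1"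
      by blast
    have ij: "i \<noteq> j" "j \<in> S" using insert by auto
    with no[of j] obtain Z where Z: "r \<notin> Z" "cut_size en F Z + card {k \<in> {i, j}. \<sigma> k \<notin> Z} < 2"
      by (auto simp: joined_def not_le)
    have "{k \<in> {i, j}. \<sigma> k \<notin> Z} = (if \<sigma> i \<in> Z then {} else {i}) \<union> (if \<sigma> j \<in> Z then {} else {j})"
      by auto
    then have "card {k \<in> {i, j}. \<sigma> k \<notin> Z} = of_bool (\<sigma> i \<notin> Z) + of_bool (\<sigma> j \<notin> Z)"
      using ij by simp
    with Z have Z2: "cut_size en F Z + of_bool (\<sigma> i \<notin> Z) + of_bool (\<sigma> j \<notin> Z) \<le> 1" by simp
    have jZ: "\<sigma> j \<in> Z"
    proof (rule ccontr)
      assume "\<sigma> j \<notin> Z"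
      then have "\<sigma> i \<in> Z" "cut_size en F Z = 0" using Z2 by (auto split: split_of_bool_asm)
      then show False using conn[of Z] Z by simp
    qed
    note sub = cut_size_submodular[OF F, of en Y Z]
    \<comment> \<open>If \<open>\<sigma> i\<close> lies in both sets, \<open>conn\<close> gives the
      intersection a crossing edge, which pays for the union. Otherwise one of the two cuts is
      empty.\<close>
    have "cut_size en F (Y \<union> Z) + of_bool (\<sigma> i \<notin> Y \<union> Z) \<le> 1"
      using sub Y(3) Z2 conn[of "Y \<inter> Z"] Y(1)
      by (cases "\<sigma> i \<in> Y"; cases "\<sigma> i \<in> Z") (auto simp: jZ)
    moreover have "r \<notin> Y \<union> Z" "\<sigma> ` insert j J \<subseteq> Y \<union> Z" using Y Z jZ by auto
    ultimately show ?case by (intro exI[of _ "Y \<union> Z"] conjI)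
  qed
  from this[of "S - {i}"] S obtain Y where Y: "r \<notin> Y" "\<sigma> ` (S - {i}) \<subseteq> Y"
    "cut_size en F Y + of_bool (\<sigma> i \<notin> Y) \<le> 1" by auto
  have "{k \<in> S. \<sigma> k \<notin> Y} \<subseteq> (if \<sigma> i \<in> Y then {} else {i})" using Y(2) by auto
  then have "card {k \<in> S. \<sigma> k \<notin> Y} \<le> card (if \<sigma> i \<in> Y then {} else {i})"
    by (rule card_mono[rotated]) simp
  also have "\<dots> = of_bool (\<sigma> i \<notin> Y)" by simp
  finally have "card {k \<in> S. \<sigma> k \<notin> Y} \<le> of_bool (\<sigma> i \<notin> Y)" .
  moreover have "2 \<le> cut_size en F Y + card {k \<in> S. \<sigma> k \<notin> Y}"
    using S(3) Y(1) by (simp add: joined_def)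
  ultimately show False using Y(3) by linarith
qed

text \<open>In matroid terms, rank two leaves an element that is not a loop. Sets that no edge
  crosses are closed under union, so if every end were in one avoiding \<open>r\<close>, their union
  would refute \<open>joined\<close>.\<close>

lemma connected_element_exists:
  assumes F: "finite F" and S: "finite S" "joined r en F \<sigma> S"
  obtains i where "i \<in> S" "\<And>Y. r \<notin> Y \<Longrightarrow> \<sigma> i \<in> Y \<Longrightarrow> 1 \<le> cut_size en F Y"
proof (rule ccontr)
  assume "\<not> thesis"
  with that have no: "\<exists>Y. r \<notin> Y \<and> \<sigma> j \<in> Y \<and> cut_size en F Y = 0" if "j \<in> S" for j
    using that by (metis less_one not_less)
  have "\<exists>Y. r \<notin> Y \<and> \<sigma> ` J \<subseteq> Y \<and> cut_size en F Y = 0" if "finite J" "J \<subseteq> S" for J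
    using that
  proof (induction J rule: finite_induct)
    case empty
    show ?case by (intro exI[of _ "{}"]) simp
  next
    case (insert j J)
    then obtain Y where Y: "r \<notin> Y" "\<sigma> ` J \<subseteq> Y" "cut_size en F Y = 0" by blast
    obtain Z where Z: "r \<notin> Z" "\<sigma> j \<in> Z" "cut_size en F Z = 0"
      using no[of j] insert by blast
    have "cut_size en F (Y \<union> Z) = 0" using cut_size_submodular[OF F, of en Y Z] Y Z by simp
    moreover have "r \<notin> Y \<union> Z" "\<sigma> ` insert j J \<subseteq> Y \<union> Z" using Y Z by auto
    ultimately show ?case by (intro exI[of _ "Y \<union> Z"] conjI)
  qed
  from this[of S] S obtain Y where Y: "r \<notin> Y" "\<sigma> ` S \<subseteq> Y" "cut_size en F Y = 0" by auto
  then have "{k \<in> S. \<sigma> k \<notin> Y} = {}" by auto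
  then have "card {k \<in> S. \<sigma> k \<notin> Y} = 0" by (simp only: card.empty)
  then show False using S(2) Y unfolding joined_def by fastforce
qed

lemma joined_pair_extends:
  assumes F: "finite F" and S: "finite S" "joined r en F \<sigma> S"
    and A: "A = {i \<in> S. \<sigma> i \<in> biconn r en F}" "card A \<le> 1"
  obtains T where "A \<subseteq> T" "T \<subseteq> S" "card T = 2" "joined r en F \<sigma> T"
proof -
  have "finite A" using S A by simp
  then consider "A = {}" | i where "A = {i}"
    using A(2) by (metis One_nat_def card_1_singletonE card_0_eq le_Suc_eq le_zero_eq)
  then obtain i where i: "i \<in> S" "A \<subseteq> {i}" "\<And>Y. r \<notin> Y \<Longrightarrow> \<sigma> i \<in> Y \<Longrightarrow> 1 \<le> cut_size en F Y"
  proof cases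
    case 1
    then show ?thesis using connected_element_exists[OF F S] that by blast
  next
    case (2 i)
    then have "i \<in> S" "\<sigma> i \<in> biconn r en F" using A by auto
    then show ?thesis using 2 that[of i] biconnD[of "\<sigma> i" r en F] by fastforce
  qed
  from joined_pair_exists[OF F S(1) i(1) S(2) i(3)]
  obtain j where "j \<in> S" "j \<noteq> i" "joined r en F \<sigma> {i, j}" by blast
  then show ?thesis using that[of "{i, j}"] i by auto
qed

text \<open>Matroid partition for rank two on four elements. Any two elements of \<open>A\<close>
  form a base on the first side and any two of \<open>B\<close> on the second. Only a class with at
  most one element is delicate: a base containing it leaves elements of the other class
  only.\<close>

lemma joined_partition:
  assumes F: "finite F" "finite F'" and S: "card S = 4" "joined r en F \<sigma> S" "joined r en F' \<sigma> S"
    and cover: "\<And>i. i \<in> S \<Longrightarrow> \<sigma> i \<in> biconn r en F \<union> biconn r en F'"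
  obtains T where "T \<subseteq> S" "card T = 2" "card (S - T) = 2" "joined r en F \<sigma> T" "joined r en F' \<sigma> (S - T)"
proof -
  have finS: "finite S" using S(1) card.infinite by force
  define A where "A = {i \<in> S. \<sigma> i \<in> biconn r en F}"
  define B where "B = {i \<in> S. \<sigma> i \<in> biconn r en F'}"
  have AB: "A \<union> B = S" using cover by (auto simp: A_def B_def)
  then have sub: "A \<subseteq> S" "B \<subseteq> S" "S - A \<subseteq> B" "S - B \<subseteq> A" by auto
  have cd: "card (S - T) = 2" if "T \<subseteq> S" "card T = 2" for T
    using that S(1) finS by (simp add: card_Diff_subset finite_subset)
  have jA: "joined r en F \<sigma> T" if "T \<subseteq> A" "card T = 2" for T
    using that joined_biconn[of T \<sigma> r en F] by (auto simp: A_def)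
  have jB: "joined r en F' \<sigma> T" if "T \<subseteq> B" "card T = 2" for T
    using that joined_biconn[of T \<sigma> r en F'] by (auto simp: B_def)
  show ?thesis
  proof (cases "card A \<le> 1")
    case True
    from joined_pair_extends[OF F(1) finS S(2) A_def True] obtain T
      where T: "A \<subseteq> T" "T \<subseteq> S" "card T = 2" "joined r en F \<sigma> T" by blast
    have "S - T \<subseteq> B" using T(1) sub(3) by blast
    then show ?thesis using that[of T] cd[of T] jB[of "S - T"] T by simp
  next
    case A2: False
    show ?thesis
    proof (cases "card B \<le> 1")
      case True
      from joined_pair_extends[OF F(2) finS S(3) B_def True] obtain T
        where T: "B \<subseteq> T" "T \<subseteq> S" "card T = 2" "joined r en F' \<sigma> T" by blast
      have "S - (S - T) = T" "S - T \<subseteq> A" using T(1,2) sub(4) by blast+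
      then show ?thesis using that[of "S - T"] cd[of T] jA[of "S - T"] T by simp
    next
      case False
      have "card (S - B) \<le> 2" using False S(1) sub finS by (simp add: card_Diff_subset finite_subset)
      moreover have "2 \<le> card A" "finite A" using A2 sub(1) finS by (auto intro: finite_subset)
      ultimately obtain T where T: "S - B \<subseteq> T" "T \<subseteq> A" "card T = 2"
        using exists_subset_between[of "S - B" 2 A] sub(4) by blast
      then have "S - T \<subseteq> B" "T \<subseteq> S" using sub by blast+
      then show ?thesis using that[of T] cd[of T] jA[of T] jB[of "S - T"] T by simp
    qed
  qed
qed

section \<open>Lifting a valid list back through a splitting\<close>

text \<open>
  In \<open>en'\<close> the edges at \<open>v\<close> are split off in pairs; \<open>e1\<close> and \<open>e3\<close> are reused as the names of the
  two new edges.
\<close>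

locale pinching =
  fixes r v :: 'v and en :: "'e \<Rightarrow> 'v uprod" and e1 e2 e3 e4 :: 'e and s1 s2 s3 s4 :: 'v and E0 :: "'e set"
  assumes dist: "distinct [e1, e2, e3, e4]"
    and E0: "finite E0" "{e1, e2, e3, e4} \<inter> E0 = {}"
    and ends: "en e1 = Upair v s1" "en e2 = Upair v s2" "en e3 = Upair v s3" "en e4 = Upair v s4"
begin

definition en' :: "'e \<Rightarrow> 'v uprod" where "en' = en(e1 := Upair s1 s2, e3 := Upair s3 s4)"

lemma en'_simps [simp]: "en' e1 = Upair s1 s2" "en' e3 = Upair s3 s4"
  "e \<in> E0 \<Longrightarrow> en' e = en e"
  using dist E0 by (auto simp: en'_def)

lemma cut_size_en': "F \<subseteq> E0 \<Longrightarrow> cut_size en' F Y = cut_size en F Y"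
  by (rule cut_size_cong) (simp add: subsetD)

lemma biconn_en': "F \<subseteq> E0 \<Longrightarrow> biconn r en' F = biconn r en F"
  by (rule biconn_cong) (simp add: subsetD)

text \<open>Wherever \<open>v\<close> lies, a set that separates \<open>s1\<close> from
  \<open>s2\<close> is crossed by \<open>e1\<close> or \<open>e2\<close>. The map
  \<open>\<phi>\<close> picks one of them, and likewise for the other pair, so no cut
  shrinks.\<close>

lemma biconn_pinch:
  assumes u: "u \<in> biconn r en' F" and F: "F \<subseteq> E0 \<union> {e1, e3}" "finite F'" "F \<subseteq> F'"
    "e1 \<in> F \<Longrightarrow> e2 \<in> F'" "e3 \<in> F \<Longrightarrow> e4 \<in> F'"
  shows "u \<in> biconn r en F'"
  unfolding biconn_def
proof (intro CollectI allI impI)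
  fix X assume X: "u \<in> X" "r \<notin> X"
  define \<phi> where "\<phi> = (\<lambda>e. if e = e1 \<and> \<not> crosses X (en e1) then e2
    else if e = e3 \<and> \<not> crosses X (en e3) then e4 else e)"
  have "card {e \<in> F. crosses X (en' e)} \<le> card {e \<in> F'. crosses X (en e)}"
  proof (rule card_inj_on_le)
    have \<phi>: "\<phi> e1 \<in> {e1, e2}" "\<phi> e3 \<in> {e3, e4}"
      using dist by (auto simp: \<phi>_def)
    have \<phi>0: "\<phi> e = e" if "e \<in> E0" for e using that E0 by (auto simp: \<phi>_def)
    have "inj_on \<phi> (E0 \<union> {e1, e3})"
    proof (rule inj_onI)
      fix x y assume "x \<in> E0 \<union> {e1, e3}" "y \<in> E0 \<union> {e1, e3}" and eq: "\<phi> x = \<phi> y"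
      then consider "x = y" | "x \<in> E0" "y \<in> E0" | "x \<in> E0" "y = e1" | "x \<in> E0" "y = e3"
        | "x = e1" "y \<in> E0" | "x = e3" "y \<in> E0" | "x = e1" "y = e3" | "x = e3" "y = e1"
        by blast
      then show "x = y" by cases (use eq \<phi> \<phi>0 E0 dist in auto)
    qed
    then show "inj_on \<phi> {e \<in> F. crosses X (en' e)}"
      by (rule inj_on_subset) (use F(1) in blast)
    show "\<phi> ` {e \<in> F. crosses X (en' e)} \<subseteq> {e \<in> F'. crosses X (en e)}"
    proof
      fix e' assume "e' \<in> \<phi> ` {e \<in> F. crosses X (en' e)}"
      then obtain e where e: "e \<in> F" "crosses X (en' e)" "e' = \<phi> e" by blast
      from e(1) F(1) consider (1) "e = e1" | (3) "e = e3" | (0) "e \<in> E0" by blast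
      then have "\<phi> e \<in> F' \<and> crosses X (en (\<phi> e))"
      proof cases
        case 1
        then show ?thesis using e F(3,4) dist by (auto simp: \<phi>_def ends)
      next
        case 3
        then show ?thesis using e F(3,5) dist by (auto simp: \<phi>_def ends)
      next
        case 0
        then show ?thesis using e F(3) \<phi>0 by auto
      qed
      then show "e' \<in> {e \<in> F'. crosses X (en e)}" using e by simp
    qed
  qed (use F in simp)
  then show "2 \<le> cut_size en F' X" using biconnD[OF u X] by (simp add: cut_size_def)
qed

definition end_of :: "'e \<Rightarrow> 'v" where
  "end_of e = (if e = e1 then s1 else if e = e2 then s2 else if e = e3 then s3 else s4)"

lemma end_of [simp]: "end_of e1 = s1" "end_of e2 = s2" "end_of e3 = s3" "end_of e4 = s4"
  using dist by (auto simp: end_of_def)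

lemma en_end_of: "e \<in> {e1, e2, e3, e4} \<Longrightarrow> en e = Upair v (end_of e)"
  using ends by auto

lemma card_end_of:
  "distinct es \<Longrightarrow> card {e \<in> set es. end_of e \<notin> Y} = (\<Sum>e\<leftarrow>es. of_bool (end_of e \<notin> Y))"
  by (induction es) (auto simp: Collect_conv_if conj_disj_distribR Collect_disj_eq)

text \<open>If \<open>Y\<close> contains neither end, both ends count. If it contains one, the new
  edge crosses \<open>Y\<close> and is replaced in the count by the end outside. If it contains
  both, the new edge does not cross and contributes nothing.\<close>

lemma joined_subdivided:
  assumes "F \<subseteq> E0" "e \<in> {(e1, e2), (e3, e4)}"
    "set_uprod (en' (fst e)) \<subseteq> biconn r en' (insert (fst e) F)"
  shows "joined r en F end_of {fst e, snd e}"
  unfolding joined_def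
proof (intro allI impI)
  fix Y assume Y: "r \<notin> Y"
  obtain a b where e: "e = (a, b)" by (cases e)
  have en: "en' a = Upair (end_of a) (end_of b)" "a \<noteq> b" "a \<notin> F" "finite F"
    using assms(1,2) e dist E0 by (auto intro: finite_subset)
  have "card {i \<in> set [a, b]. end_of i \<notin> Y} = of_bool (end_of a \<notin> Y) + of_bool (end_of b \<notin> Y)"
    using en(2) by (subst card_end_of) auto
  moreover have "cut_size en' (insert a F) Y = of_bool ((end_of a \<in> Y) \<noteq> (end_of b \<in> Y)) + cut_size en F Y"
    using en assms(1) by (simp add: cut_size_insert cut_size_en')
  moreover have "2 \<le> cut_size en' (insert a F) Y" if "end_of a \<in> Y \<or> end_of b \<in> Y"
    using that assms(3) Y biconnD e en by fastforce
  ultimately show "2 \<le> cut_size en F Y + card {i \<in> {fst e, snd e}. end_of i \<notin> Y}"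
    by (cases "end_of a \<in> Y"; cases "end_of b \<in> Y") (auto simp: e)
qed

lemma valid_subdivided:
  assumes val: "valid r en' (V - {v}) (xs @ e1 # ys @ e3 # zs)"
    and es: "set (xs @ e1 # ys @ e3 # zs) = E0 \<union> {e1, e3}" "distinct (xs @ e1 # ys @ e3 # zs)"
    and C: "set_uprod (en' e1) \<subseteq> biconn r en' (insert e1 (set xs))"
      "set_uprod (en' e3) \<subseteq> biconn r en' (insert e3 (set zs))"
  shows "valid r en V (xs @ e1 # e2 # ys @ e3 # e4 # zs)"
  unfolding valid_def
proof
  fix u assume u: "u \<in> V"
  have sub: "set xs \<subseteq> E0" "set ys \<subseteq> E0" "set zs \<subseteq> E0" using es E0 by auto
  show "\<exists>as bs. xs @ e1 # e2 # ys @ e3 # e4 # zs = as @ bs \<and>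
    u \<in> biconn r en (set as) \<and> u \<in> biconn r en (set bs)"
  proof (cases "u = v")
    case True
    have "v \<in> biconn r en (set xs \<union> {e1, e2})"
      using joined_subdivided[of "set xs" "(e1, e2)"] C(1) sub E0 dist
      by (intro biconn_attach[where \<sigma>=end_of]) (auto simp: ends)
    moreover have "v \<in> biconn r en (set zs \<union> {e3, e4})"
      using joined_subdivided[of "set zs" "(e3, e4)"] C(2) sub E0 dist
      by (intro biconn_attach[where \<sigma>=end_of]) (auto simp: ends)
    then have "v \<in> biconn r en (set (ys @ e3 # e4 # zs))"
      by (rule biconn_monoD) auto
    ultimately show ?thesis using True
      by (intro exI[of _ "xs @ [e1, e2]"] exI[of _ "ys @ e3 # e4 # zs"]) (simp add: insert_commute)
  next
    case False
    with u have "u \<in> V - {v}" by simp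
    with val obtain as bs where split: "as @ bs = xs @ e1 # ys @ e3 # zs"
      and m: "u \<in> biconn r en' (set as)" "u \<in> biconn r en' (set bs)"
      unfolding valid_def by metis
    \<comment> \<open>Substituting in the two parts separately preserves every old split, as
      \<open>e1\<close> stays together with \<open>e2\<close> and \<open>e3\<close> with
      \<open>e4\<close>.\<close>
    define h where "h = (\<lambda>e. if e = e1 then [e1, e2] else if e = e3 then [e3, e4] else [e])"
    have id: "concat (map h ws) = ws" if "set ws \<subseteq> E0" for ws
      using that E0 by (induction ws) (auto simp: h_def)
    have "concat (map h (as @ bs)) = xs @ e1 # e2 # ys @ e3 # e4 # zs"
      unfolding split using sub dist by (simp add: id) (auto simp: h_def)
    moreover have "u \<in> biconn r en (set (concat (map h ws)))"
      if "u \<in> biconn r en' (set ws)" "set ws \<subseteq> E0 \<union> {e1, e3}" for ws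
      using that by (rule biconn_pinch) (use dist in \<open>auto simp: h_def\<close>)
    moreover have "set as \<subseteq> E0 \<union> {e1, e3}" "set bs \<subseteq> E0 \<union> {e1, e3}"
      using es(1) unfolding split[symmetric] by auto
    ultimately show ?thesis using m
      by (intro exI[of _ "concat (map h as)"] exI[of _ "concat (map h bs)"]) simp
  qed
qed

lemma valid_flanked:
  assumes fl: "flanked r en' (V - {v}) xs e1 e3 zs"
    and es: "set (xs @ zs) = E0" "distinct (xs @ zs)" and V: "{s1, s2, s3, s4} \<subseteq> V - {v}"
  obtains es' where "valid r en V es'" "distinct es'" "set es' = E0 \<union> {e1, e2, e3, e4}"
proof -
  let ?S = "{e1, e2, e3, e4}"
  have d: "distinct (xs @ e1 # e3 # zs)" using es E0 dist by auto
  obtain xs' zs' where fl: "flanked r en' (V - {v}) xs' e1 e3 zs'" and ms: "mset (xs' @ zs') = mset (xs @ zs)"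
    and link: "linked r en' (set xs') s1 s2 s3 s4" "linked r en' (set zs') s1 s2 s3 s4"
    by (rule flanked_linked[OF fl en'_simps(1,2) V d])
  have es': "set (xs' @ zs') = E0" "distinct (xs' @ zs')"
    using es mset_eq_setD[OF ms] mset_eq_imp_distinct_iff[OF ms] by simp_all
  have sub: "set xs' \<subseteq> E0" "set zs' \<subseteq> E0" using es' by auto
  have card4: "card {i \<in> ?S. end_of i \<notin> Y}
      = of_bool (s1 \<notin> Y) + of_bool (s2 \<notin> Y) + of_bool (s3 \<notin> Y) + of_bool (s4 \<notin> Y)" for Y
    using card_end_of[OF dist] by simp
  have j: "joined r en F end_of ?S" if "F \<subseteq> E0" "linked r en' F s1 s2 s3 s4" for F
    using that unfolding joined_def linked_def card4 by (simp add: cut_size_en' add.assoc)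
  \<comment> \<open>The splits of the far ends lie inside \<open>xs'\<close> or inside
    \<open>zs'\<close>, and the part that does not contain the pair is then within that
    side.\<close>
  have "end_of i \<in> biconn r en (set xs') \<union> biconn r en (set zs')" if "i \<in> ?S" for i
  proof -
    have "end_of i \<in> V - {v}" using that V by auto
    with fl have "(\<exists>as us. xs' = as @ us \<and> end_of i \<in> biconn r en' (set as))
      \<or> (\<exists>us bs. zs' = us @ bs \<and> end_of i \<in> biconn r en' (set bs))"
      unfolding flanked_def by blast
    moreover have "end_of i \<in> biconn r en' (set xs')" if "xs' = as @ us" "end_of i \<in> biconn r en' (set as)" for as us
      using that(2) by (rule biconn_monoD) (use that(1) in auto)
    moreover have "end_of i \<in> biconn r en' (set zs')" if "zs' = us @ bs" "end_of i \<in> biconn r en' (set bs)" for us bs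
      using that(2) by (rule biconn_monoD) (use that(1) in auto)
    ultimately have "end_of i \<in> biconn r en' (set xs') \<union> biconn r en' (set zs')" by blast
    then show ?thesis using biconn_en' sub by simp
  qed
  note cover = this
  have "card ?S = 4" using dist by simp
  from joined_partition[OF _ _ this j[OF sub(1) link(1)] j[OF sub(2) link(2)] cover]
  obtain T where T: "T \<subseteq> ?S" "joined r en (set xs') end_of T" "joined r en (set zs') end_of (?S - T)"
    by (metis List.finite_set)
  have finT: "finite T" using T(1) by (rule finite_subset) simp
  then obtain ps where ps: "set ps = T" "distinct ps" using finite_distinct_list by blast
  obtain qs where qs: "set qs = ?S - T" "distinct qs" using finite_distinct_list[of "?S - T"] by auto
  \<comment> \<open>The split between \<open>ps\<close> and \<open>qs\<close> serves
    \<open>v\<close>. All other vertices keep their splits, which leave all four new edges on the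
    side where the pair was.\<close>
  have "valid r en V (xs' @ ps @ qs @ zs')"
    unfolding valid_def
  proof
    fix u assume u: "u \<in> V"
    show "\<exists>as bs. xs' @ ps @ qs @ zs' = as @ bs \<and> u \<in> biconn r en (set as) \<and> u \<in> biconn r en (set bs)"
    proof (cases "u = v")
      case True
      have "v \<in> biconn r en (set xs' \<union> T)"
        by (rule biconn_attach[where \<sigma>=end_of])
          (use T(1) sub(1) E0(2) in \<open>auto intro: en_end_of finT T(2)\<close>)
      moreover have "v \<in> biconn r en (set zs' \<union> (?S - T))"
        by (rule biconn_attach[where \<sigma>=end_of])
          (use T(1) sub(2) E0(2) in \<open>auto intro: en_end_of T(3)\<close>)
      ultimately have "v \<in> biconn r en (set (xs' @ ps))" "v \<in> biconn r en (set (qs @ zs'))"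
        using ps qs by (simp_all add: Un_commute)
      then show ?thesis using True by (intro exI[of _ "xs' @ ps"] exI[of _ "qs @ zs'"]) simp
    next
      case False
      with u have "u \<in> V - {v}" by simp
      with fl consider as us where "xs' = as @ us" "u \<in> biconn r en' (set as)" "u \<in> biconn r en' (set (us @ e1 # e3 # zs'))"
        | us bs where "zs' = us @ bs" "u \<in> biconn r en' (set (xs' @ e1 # e3 # us))" "u \<in> biconn r en' (set bs)"
        unfolding flanked_def by blast
      then show ?thesis
      proof cases
        case 1
        have "u \<in> biconn r en (set as)" using 1 sub biconn_en'[of "set as"] by auto
        moreover have "u \<in> biconn r en (set (us @ ps @ qs @ zs'))"
          using 1(3) by (rule biconn_pinch) (use 1(1) sub ps qs in auto)
        ultimately show ?thesis using 1 by (intro exI[of _ as] exI[of _ "us @ ps @ qs @ zs'"]) simp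
      next
        case 2
        have "u \<in> biconn r en (set bs)" using 2 sub biconn_en'[of "set bs"] by auto
        moreover have "u \<in> biconn r en (set (xs' @ ps @ qs @ us))"
          using 2(2) by (rule biconn_pinch) (use 2(1) sub ps qs in auto)
        ultimately show ?thesis using 2 by (intro exI[of _ "xs' @ ps @ qs @ us"] exI[of _ bs]) simp
      qed
    qed
  qed
  moreover have "distinct (xs' @ ps @ qs @ zs')" "set (xs' @ ps @ qs @ zs') = E0 \<union> ?S"
    using es' ps qs T(1) E0 by auto
  ultimately show ?thesis using that by blast
qed

lemma valid_pinch_ordered:
  assumes val: "valid r en' (V - {v}) (xs @ e1 # ys @ e3 # zs)"
    and es: "set (xs @ e1 # ys @ e3 # zs) = E0 \<union> {e1, e3}" "distinct (xs @ e1 # ys @ e3 # zs)"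
    and V: "{s1, s2, s3, s4} \<subseteq> V - {v}"
  obtains es' where "valid r en V es'" "distinct es'" "set es' = E0 \<union> {e1, e2, e3, e4}"
proof -
  from pull_together[OF val] consider
    xs' ys' zs' where "valid r en' (V - {v}) (xs' @ e1 # ys' @ e3 # zs')"
            "mset (xs' @ e1 # ys' @ e3 # zs') = mset (xs @ e1 # ys @ e3 # zs)"
            "set_uprod (en' e1) \<subseteq> biconn r en' (insert e1 (set xs'))"
            "set_uprod (en' e3) \<subseteq> biconn r en' (insert e3 (set zs'))"
    | xs' zs' where "flanked r en' (V - {v}) xs' e1 e3 zs'" "mset (xs' @ zs') = mset (xs @ ys @ zs)"
    by blast
  then show ?thesis
  proof cases
    case 1
    have es': "set (xs' @ e1 # ys' @ e3 # zs') = E0 \<union> {e1, e3}" "distinct (xs' @ e1 # ys' @ e3 # zs')"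
      using es mset_eq_setD[OF 1(2)] mset_eq_imp_distinct_iff[OF 1(2)] by simp_all
    have "distinct (xs' @ e1 # e2 # ys' @ e3 # e4 # zs')"
      "set (xs' @ e1 # e2 # ys' @ e3 # e4 # zs') = E0 \<union> {e1, e2, e3, e4}"
      using es' dist E0 by auto
    then show ?thesis using that valid_subdivided[OF 1(1) es' 1(3,4)] by blast
  next
    case 2
    have "set (xs' @ zs') = E0" "distinct (xs' @ zs')"
      using es mset_eq_setD[OF 2(2)] mset_eq_imp_distinct_iff[OF 2(2)] E0 by auto
    from valid_flanked[OF 2(1) this V] that show ?thesis by blast
  qed
qed

end

lemma (in pinching) valid_pinch:
  assumes val: "valid r en' (V - {v}) es" and es: "set es = E0 \<union> {e1, e3}" "distinct es"
    and V: "{s1, s2, s3, s4} \<subseteq> V - {v}"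
  obtains es' where "valid r en V es'" "distinct es'" "set es' = E0 \<union> {e1, e2, e3, e4}"
proof -
  obtain xs ws where ws: "es = xs @ e1 # ws" using es(1) by (metis Un_iff insertI1 split_list)
  have "e3 \<in> set xs \<union> set ws" using es(1) ws dist by auto
  then consider ys zs where "es = xs @ e1 # ys @ e3 # zs" | ys zs where "es = ys @ e3 # zs @ e1 # ws"
    using ws by (fastforce dest: split_list)
  then show ?thesis
  proof cases
    case 1
    show ?thesis using valid_pinch_ordered[of V xs ys zs thesis] val es V that unfolding 1 by simp
  next
    case 2
    interpret swapped: pinching r v en e3 e4 e1 e2 s3 s4 s1 s2 E0
      using dist E0 ends by unfold_locales auto
    have "swapped.en' = en'" using dist by (auto simp: swapped.en'_def en'_def fun_upd_twist)
    then show ?thesis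
      using swapped.valid_pinch_ordered[of V ys zs ws thesis] val es V that unfolding 2
      by (simp add: insert_commute)
  qed
qed

section \<open>Reduction at a vertex of degree four\<close>

text \<open>Loops are ignored, and a single vertex qualifies trivially; this is where the induction
  bottoms out.\<close>

definition four_connected :: "'v set \<Rightarrow> 'e set \<Rightarrow> ('e \<Rightarrow> 'v uprod) \<Rightarrow> bool" where
  "four_connected V E en \<longleftrightarrow> (\<forall>X. X \<subset> V \<longrightarrow> X \<noteq> {} \<longrightarrow> 4 \<le> cut_size en E X)"

lemma four_connectedD: "four_connected V E en \<Longrightarrow> X \<subset> V \<Longrightarrow> X \<noteq> {} \<Longrightarrow> 4 \<le> cut_size en E X"
  by (simp add: four_connected_def)

lemma cut_size_complement:
  assumes "\<And>e. e \<in> E \<Longrightarrow> set_uprod (en e) \<subseteq> V"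
  shows "cut_size en E (V - X) = cut_size en E X"
proof (rule cut_size_cong)
  fix e assume "e \<in> E"
  then show "crosses (V - X) (en e) = crosses X (en e)" using assms[of e] by (cases "en e") auto
qed

lemma tight_cut_exists:
  assumes fin: "finite E" and wf: "\<And>e. e \<in> E \<Longrightarrow> set_uprod (en e) \<subseteq> V"
    and conn: "four_connected V E en" and e: "e \<in> E" "\<not> four_connected V (E - {e}) en"
  obtains X where "X \<subset> V" "X \<noteq> {}" "r \<notin> X" "crosses X (en e)" "cut_size en E X = 4"
proof -
  from e(2) obtain X where X: "X \<subset> V" "X \<noteq> {}" "cut_size en (E - {e}) X < 4"
    by (auto simp: four_connected_def not_le)
  have "cut_size en E X = of_bool (crosses X (en e)) + cut_size en (E - {e}) X"
    using cut_size_insert[of "E - {e}" e en X] fin e(1) by (simp add: insert_absorb)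
  with X four_connectedD[OF conn X(1,2)] have t: "crosses X (en e)" "cut_size en E X = 4"
    by (auto split: split_of_bool_asm)
  show ?thesis
  proof (cases "r \<in> X")
    case True
    have "crosses (V - X) (en e)" using t(1) wf[OF e(1)] by (cases "en e") auto
    moreover have "cut_size en E (V - X) = 4" using cut_size_complement[of E en V X] wf t(2) by simp
    ultimately show ?thesis using that[of "V - X"] X True by blast
  next
    case False
    then show ?thesis using that X t by blast
  qed
qed

text \<open>No edge lies inside a smallest tight set \<open>X\<close> avoiding \<open>r\<close>: it
  would cross another tight set \<open>Y\<close>, and uncrossing would make
  \<open>X \<inter> Y\<close> tight. The union stays proper because both sets avoid
  \<open>r\<close>. Without inner edges the cuts of \<open>{v}\<close> and \<open>X - {v}\<close>
  add up, to at least eight unless \<open>X\<close> is a single vertex.\<close>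

lemma degree_four_vertex:
  assumes fin: "finite V" "finite E" and wf: "\<And>e. e \<in> E \<Longrightarrow> set_uprod (en e) \<subseteq> V"
    and conn: "four_connected V E en" and r: "r \<in> V" "V \<noteq> {r}"
    and crit: "\<And>e. e \<in> E \<Longrightarrow> \<not> four_connected V (E - {e}) en"
  obtains v where "v \<in> V" "v \<noteq> r" "cut_size en E {v} = 4"
proof -
  define \<S> where "\<S> = {X. X \<subset> V \<and> X \<noteq> {} \<and> r \<notin> X \<and> cut_size en E X = 4}"
  have tight: "\<exists>X\<in>\<S>. crosses X (en e)" if e: "e \<in> E" for e
    by (rule tight_cut_exists[OF fin(2) wf conn e crit[OF e], where r=r]) (auto simp: \<S>_def)
  have "4 \<le> cut_size en E {r}" using four_connectedD[OF conn, of "{r}"] r by blast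
  then have "E \<noteq> {}" by (auto simp: cut_size_def)
  then have "\<S> \<noteq> {}" using tight by blast
  moreover have "finite \<S>" unfolding \<S>_def by (rule finite_subset[of _ "Pow V"]) (use fin in auto)
  ultimately obtain X where X: "X \<in> \<S>" and min: "\<And>Y. Y \<in> \<S> \<Longrightarrow> card X \<le> card Y"
    using ex_min_if_finite[of "card ` \<S>"] by (auto simp: not_less)
  have XV: "X \<subset> V" "X \<noteq> {}" "r \<notin> X" "cut_size en E X = 4" using X by (auto simp: \<S>_def)
  have finX: "finite X" using XV(1) fin(1) by (auto intro: finite_subset)
  have no_inside: "\<not> (a \<in> X \<and> b \<in> X)" if e: "e \<in> E" "en e = Upair a b" for e a b
  proof
    assume ab: "a \<in> X \<and> b \<in> X"
    obtain Y where Y: "Y \<in> \<S>" "crosses Y (en e)" using tight[OF e(1)] by blast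
    then have ne: "X \<inter> Y \<noteq> {}" "X \<inter> Y \<subset> X" using ab e(2) by auto
    have YV: "Y \<subset> V" "r \<notin> Y" "cut_size en E Y = 4" using Y(1) by (auto simp: \<S>_def)
    have "X \<inter> Y \<subset> V" "X \<union> Y \<subset> V" using XV YV r by blast+
    then have "4 \<le> cut_size en E (X \<inter> Y)" "4 \<le> cut_size en E (X \<union> Y)"
      using four_connectedD[OF conn] ne by blast+
    then have "cut_size en E (X \<inter> Y) = 4"
      using cut_size_submodular[OF fin(2), of en X Y] XV(4) YV(3) by linarith
    then have "X \<inter> Y \<in> \<S>" using ne XV YV by (auto simp: \<S>_def)
    then show False using min[of "X \<inter> Y"] psubset_card_mono[OF finX ne(2)] by simp
  qed
  obtain v where v: "v \<in> X" using XV by blast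
  have "X - {v} = {}"
  proof (rule ccontr)
    assume ne: "X - {v} \<noteq> {}"
    have "cut_size en E {v} + cut_size en E (X - {v}) \<le> cut_size en E X"
      unfolding cut_size_sum[OF fin(2)] sum.distrib[symmetric]
    proof (rule sum_mono)
      fix e assume "e \<in> E"
      then show "of_bool (crosses {v} (en e)) + of_bool (crosses (X - {v}) (en e))
        \<le> (of_bool (crosses X (en e)) :: nat)"
        using no_inside[of e] v by (cases "en e") auto
    qed
    moreover have "{v} \<subset> V" "X - {v} \<subset> V" using XV v r by auto
    then have "4 \<le> cut_size en E {v}" "4 \<le> cut_size en E (X - {v})"
      using ne four_connectedD[OF conn] by blast+
    ultimately show False using XV(4) by linarith
  qed
  then have "X = {v}" using v by blast
  then show ?thesis using that[of v] XV by auto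
qed

section \<open>Splitting off preserves the connectivity\<close>

locale splitting = pinching r v en e1 e2 e3 e4 s1 s2 s3 s4 E0
  for r v :: 'v and en :: "'e \<Rightarrow> 'v uprod" and e1 e2 e3 e4 s1 s2 s3 s4 E0 +
  fixes V :: "'v set"
  assumes V: "v \<in> V" "{s1, s2, s3, s4} \<subseteq> V - {v}"
    and wf0: "\<And>e. e \<in> E0 \<Longrightarrow> set_uprod (en e) \<subseteq> V - {v}"
    and conn: "four_connected V (E0 \<union> {e1, e2, e3, e4}) en"
begin

text \<open>The two bounds come from the cuts of \<open>X\<close> and of \<open>insert v X\<close>
  in the original graph, where an edge at \<open>v\<close> counts iff its far end is on the other
  side.\<close>

lemma cut_size_large:
  assumes "X \<subseteq> V - {v}"
  shows "X \<noteq> {} \<Longrightarrow> 4 \<le> cut_size en E0 X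
      + of_bool (s1 \<in> X) + of_bool (s2 \<in> X) + of_bool (s3 \<in> X) + of_bool (s4 \<in> X)"
    and "X \<noteq> V - {v} \<Longrightarrow> 4 \<le> cut_size en E0 X
      + of_bool (s1 \<notin> X) + of_bool (s2 \<notin> X) + of_bool (s3 \<notin> X) + of_bool (s4 \<notin> X)"
proof -
  have full: "cut_size en (E0 \<union> {e1, e2, e3, e4}) Y = cut_size en E0 Y
      + of_bool ((v \<in> Y) \<noteq> (s1 \<in> Y)) + of_bool ((v \<in> Y) \<noteq> (s2 \<in> Y))
      + of_bool ((v \<in> Y) \<noteq> (s3 \<in> Y)) + of_bool ((v \<in> Y) \<noteq> (s4 \<in> Y))" for Y
    using E0 dist by (simp add: cut_size_insert ends)
  have vX: "v \<notin> X" using assms by blast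
  show "4 \<le> cut_size en E0 X
      + of_bool (s1 \<in> X) + of_bool (s2 \<in> X) + of_bool (s3 \<in> X) + of_bool (s4 \<in> X)" if "X \<noteq> {}"
  proof -
    have "X \<subset> V" using assms V by blast
    from four_connectedD[OF conn this that] show ?thesis unfolding full using vX by simp
  qed
  have "crosses (insert v X) (en e) = crosses X (en e)" if "e \<in> E0" for e
    using wf0[OF that] by (cases "en e") auto
  then have "cut_size en E0 (insert v X) = cut_size en E0 X" by (rule cut_size_cong)
  note cut_v = this
  show "4 \<le> cut_size en E0 X
      + of_bool (s1 \<notin> X) + of_bool (s2 \<notin> X) + of_bool (s3 \<notin> X) + of_bool (s4 \<notin> X)" if "X \<noteq> V - {v}"
  proof -
    have "insert v X \<subset> V" using that assms V by blast
    from four_connectedD[OF conn this] have "4 \<le> cut_size en (E0 \<union> {e1, e2, e3, e4}) (insert v X)"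
      by simp
    moreover have "s1 \<noteq> v" "s2 \<noteq> v" "s3 \<noteq> v" "s4 \<noteq> v" using V by auto
    ultimately show ?thesis unfolding full cut_v by simp
  qed
qed

text \<open>By the two bounds of \<open>cut_size_large\<close>, a cut that has become too small has
  one new edge inside it and the other outside. Passing to the complement puts the first one
  inside.\<close>

lemma obstruction:
  assumes "\<not> four_connected (V - {v}) (E0 \<union> {e1, e3}) en'"
  obtains X where "X \<subseteq> V - {v}" "s1 \<in> X" "s2 \<in> X" "s3 \<notin> X" "s4 \<notin> X" "cut_size en E0 X \<le> 3"
proof -
  from assms obtain X where X: "X \<subset> V - {v}" "X \<noteq> {}" "cut_size en' (E0 \<union> {e1, e3}) X < 4"
    by (auto simp: four_connected_def not_le)
  have "cut_size en' (E0 \<union> {e1, e3}) X = cut_size en E0 X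
      + of_bool ((s1 \<in> X) \<noteq> (s2 \<in> X)) + of_bool ((s3 \<in> X) \<noteq> (s4 \<in> X))"
    using E0 dist by (simp add: cut_size_insert cut_size_en')
  with X(3) cut_size_large[of X] X(1,2)
  have "cut_size en E0 X \<le> 3 \<and> (s1 \<in> X \<and> s2 \<in> X \<and> s3 \<notin> X \<and> s4 \<notin> X \<or> s1 \<notin> X \<and> s2 \<notin> X \<and> s3 \<in> X \<and> s4 \<in> X)"
    by (cases "s1 \<in> X"; cases "s2 \<in> X"; cases "s3 \<in> X"; cases "s4 \<in> X"; simp add: psubset_eq)
  moreover have "cut_size en E0 (V - {v} - X) = cut_size en E0 X"
    using wf0 by (rule cut_size_complement)
  ultimately show ?thesis using that[of X] that[of "V - {v} - X"] X(1) V by auto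
qed

end

text \<open>
  Obstructions to two of the three pairings have corners of cut size 3 only, against parity.
\<close>

lemma (in splitting) split_off:
  assumes "\<not> four_connected (V - {v}) (E0 \<union> {e1, e3}) en'"
  shows "four_connected (V - {v}) (E0 \<union> {e1, e2}) (en(e1 := Upair s1 s3, e2 := Upair s2 s4))"
proof (rule ccontr)
  interpret other: splitting r v en e1 e3 e2 e4 s1 s3 s2 s4 E0 V
    using dist E0 ends V wf0 conn by unfold_locales (auto simp: insert_commute)
  assume "\<not> ?thesis"
  then have "\<not> four_connected (V - {v}) (E0 \<union> {e1, e2}) other.en'" by (simp add: other.en'_def)
  then obtain Y where Y: "Y \<subseteq> V - {v}" "s1 \<in> Y" "s3 \<in> Y" "s2 \<notin> Y" "s4 \<notin> Y" "cut_size en E0 Y \<le> 3"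
    by (rule other.obstruction)
  obtain X where X: "X \<subseteq> V - {v}" "s1 \<in> X" "s2 \<in> X" "s3 \<notin> X" "s4 \<notin> X" "cut_size en E0 X \<le> 3"
    using assms by (rule obstruction)
  \<comment> \<open>The three corners and the outside of the union each contain exactly one of the
    four far ends, so at most one of four crossing edges is missing in \<open>E0\<close>.\<close>
  have "3 \<le> cut_size en E0 (X \<inter> Y)" "3 \<le> cut_size en E0 (X - Y)" "3 \<le> cut_size en E0 (Y - X)"
    using cut_size_large(1)[of "X \<inter> Y"] cut_size_large(1)[of "X - Y"] cut_size_large(1)[of "Y - X"] X Y
    by auto
  moreover have "3 \<le> cut_size en E0 (X \<union> Y)"
    using cut_size_large(2)[of "X \<union> Y"] X Y V by auto
  ultimately have "cut_size en E0 (X \<inter> Y) = 3" "cut_size en E0 (X - Y) = 3" "cut_size en E0 X = 3"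
    using X(6) Y(6) cut_size_submodular[OF E0(1), of en X Y] cut_size_posimodular[OF E0(1), of en X Y]
    by linarith+
  then show False using even_cut_sizes[OF E0(1), of en X Y] by simp
qed

lemma splitting_exists:
  assumes fin: "finite E" and wf: "\<And>e. e \<in> E \<Longrightarrow> set_uprod (en e) \<subseteq> V"
    and conn: "four_connected V E en" and v: "v \<in> V" "cut_size en E {v} = 4"
    and no_loop: "\<And>e. e \<in> E \<Longrightarrow> en e \<noteq> Upair v v"
  obtains e1 e2 e3 e4 s1 s2 s3 s4 E0 where "splitting v en e1 e2 e3 e4 s1 s2 s3 s4 E0 V"
    "E = E0 \<union> {e1, e2, e3, e4}"
    "four_connected (V - {v}) (E0 \<union> {e1, e3}) (en(e1 := Upair s1 s2, e3 := Upair s3 s4))"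
proof -
  let ?D = "{e \<in> E. crosses {v} (en e)}"
  obtain es where es: "set es = ?D" "distinct es" using finite_distinct_list[of ?D] fin by auto
  have "length es = 4" using v(2) es distinct_card[of es] by (simp add: cut_size_def)
  then obtain e1 e2 e3 e4 where es4: "es = [e1, e2, e3, e4]"
    by (auto simp: numeral_eq_Suc length_Suc_conv)
  have "\<exists>s. en e = Upair v s \<and> s \<in> V - {v}" if "e \<in> ?D" for e
    using that wf[of e] by (cases "en e") (auto simp: Upair_inject)
  then obtain \<sigma> where \<sigma>: "\<And>e. e \<in> ?D \<Longrightarrow> en e = Upair v (\<sigma> e) \<and> \<sigma> e \<in> V - {v}" by metis
  have D: "?D = {e1, e2, e3, e4}" using es es4 by auto
  define E0 where "E0 = E - ?D"
  have E: "E = E0 \<union> {e1, e2, e3, e4}" unfolding E0_def using D by auto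
  have wf0: "set_uprod (en e) \<subseteq> V - {v}" if "e \<in> E0" for e
    using that wf[of e] no_loop[of e] unfolding E0_def by (cases "en e") auto
  interpret splitting r v en e1 e2 e3 e4 "\<sigma> e1" "\<sigma> e2" "\<sigma> e3" "\<sigma> e4" E0 V
  proof
    show "distinct [e1, e2, e3, e4]" using es es4 by simp
    show "finite E0" "{e1, e2, e3, e4} \<inter> E0 = {}" using fin D by (auto simp: E0_def)
  qed (use \<sigma> D wf0 conn v(1) E in auto)
  show ?thesis
  proof (cases "four_connected (V - {v}) (E0 \<union> {e1, e3}) en'")
    case True
    then show ?thesis using that[OF splitting_axioms E] by (simp add: en'_def)
  next
    case False
    have "splitting v en e1 e3 e2 e4 (\<sigma> e1) (\<sigma> e3) (\<sigma> e2) (\<sigma> e4) E0 V"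
      using dist E0 ends V wf0 conn by unfold_locales (auto simp: insert_commute)
    from that[OF this _ split_off[OF False]] E show ?thesis by (simp add: insert_commute)
  qed
qed

theorem valid_list_exists:
  fixes en :: "'e \<Rightarrow> 'v uprod"
  assumes "finite V" "finite E" "\<And>e. e \<in> E \<Longrightarrow> set_uprod (en e) \<subseteq> V" "r \<in> V" "four_connected V E en"
  obtains es where "distinct es" "set es = E" "valid r en V es"
proof -
  have "\<exists>es. distinct es \<and> set es = E \<and> valid r en V es"
    using assms
  proof (induction "card E" arbitrary: V E en rule: less_induct)
    case less
    note fin = less(2,3) and wf = less(4) and r = less(5) and conn = less(6)
    show ?case
    proof (cases "V = {r}")
      case True
      obtain es where "set es = E" "distinct es" using finite_distinct_list[OF fin(2)] by blast
      moreover have "valid r en V es"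
        unfolding valid_def using True
        by (intro ballI exI[of _ "[]"] exI[of _ es]) (simp add: root_in_biconn)
      ultimately show ?thesis by blast
    next
      case nontriv: False
      show ?thesis
      proof (cases "\<exists>e\<in>E. four_connected V (E - {e}) en")
        case True
        then obtain e where e: "e \<in> E" "four_connected V (E - {e}) en" by blast
        have "card (E - {e}) < card E" using fin(2) e(1) by (rule card_Diff1_less)
        moreover have "finite (E - {e})" "\<And>e'. e' \<in> E - {e} \<Longrightarrow> set_uprod (en e') \<subseteq> V"
          using fin wf by auto
        ultimately have "\<exists>es. distinct es \<and> set es = E - {e} \<and> valid r en V es"
          by (intro less(1)[OF _ fin(1) _ _ r e(2)])
        then obtain es where es: "distinct es" "set es = E - {e}" "valid r en V es" by blast
        \<comment> \<open>The place of \<open>e\<close> is arbitrary, since further edges only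
          enlarge \<open>biconn\<close>.\<close>
        have "valid r en V (e # es)"
          unfolding valid_def
        proof
          fix u assume "u \<in> V"
          with es(3) obtain as bs where "es = as @ bs" "u \<in> biconn r en (set as)" "u \<in> biconn r en (set bs)"
            unfolding valid_def by blast
          then have "e # es = (e # as) @ bs \<and> u \<in> biconn r en (set (e # as)) \<and> u \<in> biconn r en (set bs)"
            using biconn_monoD[of u r en "set as" "set (e # as)"] by auto
          then show "\<exists>as bs. e # es = as @ bs \<and> u \<in> biconn r en (set as) \<and> u \<in> biconn r en (set bs)"
            by blast
        qed
        moreover have "distinct (e # es)" "set (e # es) = E" using es e(1) by auto
        ultimately show ?thesis by blast
      next
        case False
        then have crit: "\<And>e. e \<in> E \<Longrightarrow> \<not> four_connected V (E - {e}) en" by blast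
        obtain v where v: "v \<in> V" "v \<noteq> r" "cut_size en E {v} = 4"
          by (rule degree_four_vertex[OF fin wf conn r nontriv crit])
        \<comment> \<open>Every edge crosses a tight cut here, and a loop crosses no cut.\<close>
        have no_loop: "en e \<noteq> Upair v v" if e: "e \<in> E" for e
          by (rule tight_cut_exists[OF fin(2) wf conn e crit[OF e]]) auto
        obtain e1 e2 e3 e4 s1 s2 s3 s4 E0 where
          sp: "splitting v en e1 e2 e3 e4 s1 s2 s3 s4 E0 V" and E: "E = E0 \<union> {e1, e2, e3, e4}"
          and c: "four_connected (V - {v}) (E0 \<union> {e1, e3}) (en(e1 := Upair s1 s2, e3 := Upair s3 s4))"
          by (rule splitting_exists[OF fin(2) wf conn v(1,3) no_loop])
        interpret splitting r v en e1 e2 e3 e4 s1 s2 s3 s4 E0 V by (rule sp)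
        have c': "four_connected (V - {v}) (E0 \<union> {e1, e3}) en'" using c by (simp add: en'_def)
        have "E0 \<union> {e1, e3} \<subset> E" using E E0 dist by auto
        then have "card (E0 \<union> {e1, e3}) < card E" by (rule psubset_card_mono[OF fin(2)])
        moreover have "set_uprod (en' e) \<subseteq> V - {v}" if "e \<in> E0 \<union> {e1, e3}" for e
          using that wf0[of e] V by auto
        moreover have "finite (V - {v})" "finite (E0 \<union> {e1, e3})" "r \<in> V - {v}"
          using fin(1) E0(1) r v(2) by auto
        ultimately have "\<exists>es. distinct es \<and> set es = E0 \<union> {e1, e3} \<and> valid r en' (V - {v}) es"
          by (intro less(1)[OF _ _ _ _ _ c'])
        then obtain es where es: "distinct es" "set es = E0 \<union> {e1, e3}" "valid r en' (V - {v}) es"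
          by blast
        obtain es' where "valid r en V es'" "distinct es'" "set es' = E0 \<union> {e1, e2, e3, e4}"
          by (rule valid_pinch[OF es(3,2,1) V(2)])
        then show ?thesis unfolding E by blast
      qed
    qed
  qed
  then show ?thesis using that by blast
qed

section \<open>Trees given by parent functions\<close>

lemma walk_start: "walk G u p v \<Longrightarrow> u \<in> verts G"
  by (cases p) auto

lemma walk_end: "walk G u p v \<Longrightarrow> v \<in> verts G"
  by (induction G u p v rule: walk.induct) auto

lemma walk_append: "walk G u p v \<Longrightarrow> walk G v q w \<Longrightarrow> walk G u (p @ q) w"
  by (induction G u p v rule: walk.induct) auto

lemma walk_reverse: "walk G u p v \<Longrightarrow> \<exists>q. walk G v q u"
proof (induction G u p v rule: walk.induct)
  case (1 G u v)
  then show ?case by (intro exI[of _ "[]"]) auto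
next
  case (2 G u e w p v)
  then obtain q where "walk G v q w" by auto
  moreover have "walk G w [(e, u)] u"
    using 2 walk_start[of G w p v] by (auto simp: Upair_inject)
  ultimately have "walk G v (q @ [(e, u)]) u" by (rule walk_append)
  then show ?case by blast
qed

lemma path_suffix: "path G w q v \<Longrightarrow> u \<in> set (w # map snd q) \<Longrightarrow> \<exists>q'. path G u q' v"
proof (induction q arbitrary: w)
  case Nil
  then show ?case by auto
next
  case (Cons s q)
  obtain e x where s: "s = (e, x)" by (cases s)
  show ?case
  proof (cases "u = w")
    case False
    then show ?thesis using Cons s by (auto simp: path_def)
  qed (use Cons in auto)
qed

lemma walk_imp_path: "walk G u p v \<Longrightarrow> \<exists>q. path G u q v"
proof (induction G u p v rule: walk.induct)
  case (1 G u v)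
  then show ?case by (intro exI[of _ "[]"]) (auto simp: path_def)
next
  case (2 G u e w p v)
  then obtain q where q: "path G w q v" by auto
  show ?case
  proof (cases "u \<in> set (w # map snd q)")
    case True
    then show ?thesis using path_suffix[OF q] by blast
  next
    case False
    then have "path G u ((e, w) # q) v" using q 2(2) by (auto simp: path_def)
    then show ?thesis by blast
  qed
qed

text \<open>The decreasing \<open>height\<close> ensures both that following parents ends at
  \<open>r\<close> and that no cycle closes. Rational values let the numberings below serve as
  heights.\<close>

locale parent_tree =
  fixes V :: "'v set" and r :: 'v and en :: "'e \<Rightarrow> 'v uprod"
    and parent_edge :: "'v \<Rightarrow> 'e" and parent :: "'v \<Rightarrow> 'v" and height :: "'v \<Rightarrow> rat"
  assumes fin: "finite V" and root: "r \<in> V"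
    and parent: "\<And>v. v \<in> V \<Longrightarrow> v \<noteq> r \<Longrightarrow> parent v \<in> V"
      "\<And>v. v \<in> V \<Longrightarrow> v \<noteq> r \<Longrightarrow> en (parent_edge v) = Upair v (parent v)"
      "\<And>v. v \<in> V \<Longrightarrow> v \<noteq> r \<Longrightarrow> height (parent v) < height v"
begin

definition T :: "('v, 'e) multigraph" where
  "T = \<lparr>verts = V, edges = parent_edge ` (V - {r}), ends = en\<rparr>"

lemma T_simps [simp]: "verts T = V" "edges T = parent_edge ` (V - {r})" "ends T = en"
  by (simp_all add: T_def)

lemma wf_T: "wf_multigraph T"
  using parent by (auto simp: wf_multigraph_def)

lemma walk_to_root: "v \<in> V \<Longrightarrow> \<exists>p. walk T v p r"
proof (induction "card {u \<in> V. height u < height v}" arbitrary: v rule: less_induct)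
  case less
  show ?case
  proof (cases "v = r")
    case True
    then show ?thesis using root by (intro exI[of _ "[]"]) simp
  next
    case False
    have "{u \<in> V. height u < height (parent v)} \<subset> {u \<in> V. height u < height v}"
      using parent[OF less(2) False] by force
    then have "card {u \<in> V. height u < height (parent v)} < card {u \<in> V. height u < height v}"
      using fin by (intro psubset_card_mono) auto
    from less(1)[OF this] parent(1)[OF less(2) False] obtain p where "walk T (parent v) p r" by blast
    then have "walk T v ((parent_edge v, parent v) # p) r"
      using parent[OF less(2) False] less(2) False by simp
    then show ?thesis by blast
  qed
qed

lemma connected_T: "connected T"
  unfolding connected_def
proof (intro conjI ballI)
  fix u v assume "u \<in> verts T" "v \<in> verts T"
  then obtain p q where pq: "walk T u p r" "walk T v q r" using walk_to_root by fastforce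
  obtain q' where "walk T r q' v" using walk_reverse[OF pq(2)] ..
  with pq(1) have "walk T u (p @ q') v" by (rule walk_append)
  then show "\<exists>p. path T u p v" by (rule walk_imp_path)
qed (use root in auto)

lemma walk_step:
  assumes "walk T u ((e, w) # ps) v"
  obtains (up) "u \<in> V" "u \<noteq> r" "e = parent_edge u" "w = parent u"
    | (down) "w \<in> V" "w \<noteq> r" "e = parent_edge w" "u = parent w"
proof -
  from assms obtain x where x: "x \<in> V" "x \<noteq> r" "e = parent_edge x" "en e = Upair u w" by auto
  then have "Upair x (parent x) = Upair u w" using parent(2) by metis
  then show ?thesis using that x by (auto simp: Upair_inject)
qed

text \<open>Once a walk without repeated edges has stepped away from the root it cannot turn back,
  because the only step towards the root would reuse the edge just taken.\<close>

lemma walk_first_edge: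
  "walk T u ps v \<Longrightarrow> distinct (map fst ps) \<Longrightarrow> ps \<noteq> [] \<Longrightarrow>
    fst (hd ps) = parent_edge u \<or> height u < height v"
proof (induction ps arbitrary: u)
  case (Cons s ps)
  obtain e w where s: "s = (e, w)" by (cases s)
  have w: "walk T w ps v" using Cons(2) s by simp
  from Cons(2)[unfolded s] show ?case
  proof (cases rule: walk_step)
    case up
    then show ?thesis using s by simp
  next
    case down
    then have uw: "height u < height w" using parent(3) by simp
    show ?thesis
    proof (cases "ps = []")
      case True
      then show ?thesis using w uw by simp
    next
      case False
      then have "fst (hd ps) \<noteq> e" using Cons(3) s hd_in_set[OF False] by auto
      then show ?thesis using Cons(1)[OF w _ False] Cons(3) s down uw by auto
    qed
  qed
qed simp

lemma walk_last_edge: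
  "walk T u ps v \<Longrightarrow> distinct (map fst ps) \<Longrightarrow> ps \<noteq> [] \<Longrightarrow>
    fst (last ps) = parent_edge v \<or> height v < height u"
proof (induction ps arbitrary: u)
  case (Cons s ps)
  obtain e w where s: "s = (e, w)" by (cases s)
  have w: "walk T w ps v" and d: "distinct (map fst ps)" using Cons(2,3) s by auto
  show ?case
  proof (cases "ps = []")
    case True
    from Cons(2)[unfolded s] show ?thesis
      by (cases rule: walk_step) (use w True s parent(3) in auto)
  next
    case False
    from Cons(2)[unfolded s] show ?thesis
    proof (cases rule: walk_step)
      case up
      then have "height w < height u" using parent(3) by simp
      then show ?thesis using Cons(1)[OF w d False] False by auto
    next
      case down
      have "fst (hd ps) \<noteq> e" using Cons(3) s hd_in_set[OF False] by auto
      then have "height w < height v" using walk_first_edge[OF w d False] down by auto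
      then show ?thesis using Cons(1)[OF w d False] False by auto
    qed
  qed
qed simp

text \<open>
  Without repeated edges a walk in the tree first ascends and then descends, so a cycle would
  start and end with the parent edge of its base vertex.
\<close>

lemma acyclic_T: "\<not> cycle T u p"
proof
  assume "cycle T u p"
  then have c: "walk T u p u" "p \<noteq> []" "distinct (map fst p)" by (auto simp: cycle_def)
  \<comment> \<open>For a closed walk the alternatives on heights are void. Equal first and last
    edges then leave a single step, a loop, which a parent edge cannot be.\<close>
  have "fst (hd p) = fst (last p)"
    using walk_first_edge[OF c(1,3,2)] walk_last_edge[OF c(1,3,2)] by simp
  then have "length p = 1" using c(2,3)
    by (cases p rule: rev_cases; cases p) auto
  then obtain e w where "p = [(e, w)]" by (auto simp: length_Suc_conv)
  then have "walk T u [(e, u)] u" using c(1) by simp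
  then show False by (cases rule: walk_step) (use parent(3) in force)+
qed

lemma tree_T: "tree T"
  unfolding tree_def using wf_T connected_T acyclic_T by blast

definition up :: "('v \<times> 'v) set" where
  "up = {(v, parent v) | v. v \<in> V \<and> v \<noteq> r}"

text \<open>The hypothesis on \<open>parent u\<close> forbids a first step towards the root. It is
  inherited: after a step down to \<open>w\<close>, the parent of \<open>w\<close> is a vertex
  already visited.\<close>

lemma path_edges_ancestors:
  "walk T u ps v \<Longrightarrow> distinct (u # map snd ps) \<Longrightarrow> u = r \<or> parent u \<notin> set (map snd ps) \<Longrightarrow>
    (v, u) \<in> up\<^sup>* \<and> walk_edges ps \<subseteq> parent_edge ` {w \<in> V - {r}. (v, w) \<in> up\<^sup>*}"
proof (induction ps arbitrary: u)
  case Nil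
  then show ?case by (simp add: walk_edges_def)
next
  case (Cons s ps)
  obtain e w where s: "s = (e, w)" by (cases s)
  from Cons(2)[unfolded s] show ?case
  proof (cases rule: walk_step)
    case up
    then show ?thesis using Cons(4) s by auto
  next
    case down
    have "(v, w) \<in> up\<^sup>* \<and> walk_edges ps \<subseteq> parent_edge ` {w \<in> V - {r}. (v, w) \<in> up\<^sup>*}"
      by (rule Cons(1)) (use Cons(2,3) s down in auto)
    moreover have "(w, u) \<in> up" using down by (auto simp: up_def)
    ultimately show ?thesis using down s by (auto simp: walk_edges_def intro: rtrancl_into_rtrancl)
  qed
qed

lemma path_from_root_edges:
  assumes "path T r p v" "e \<in> walk_edges p"
  obtains w where "w \<in> V" "w \<noteq> r" "(v, w) \<in> up\<^sup>*" "e = parent_edge w"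
  using assms path_edges_ancestors[of r p v] by (auto simp: path_def)

end

section \<open>Ears\<close>

lemma relpow_chain:
  assumes "\<And>i. i < n \<Longrightarrow> (f i, f (Suc i)) \<in> R" "i \<le> j" "j \<le> n"
  shows "(f i, f j) \<in> R ^^ (j - i)"
  unfolding relpow_fun_conv
  by (intro exI[of _ "\<lambda>k. f (i + k)"]) (use assms in auto)

text \<open>A chain of minimal length works, since the segment between two equal entries could be
  cut out.\<close>

lemma injective_chain_exists:
  assumes "(a, b) \<in> R\<^sup>*"
  obtains f n where "f 0 = a" "f n = b" "\<And>i. i < n \<Longrightarrow> (f i, f (Suc i)) \<in> R" "inj_on f {..n}"
proof -
  define n where "n = (LEAST n. (a, b) \<in> R ^^ n)"
  have n: "(a, b) \<in> R ^^ n" unfolding n_def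
    using assms by (metis LeastI rtrancl_imp_relpow)
  then obtain f where f: "f 0 = a" "f n = b" "\<And>i. i < n \<Longrightarrow> (f i, f (Suc i)) \<in> R"
    unfolding relpow_fun_conv by blast
  have "f i \<noteq> f j" if ij: "i < j" "j \<le> n" for i j
  proof
    assume eq: "f i = f j"
    have "(a, f i) \<in> R ^^ i" "(f i, b) \<in> R ^^ (n - j)"
      using relpow_chain[where f=f and R=R and n=n, of 0 i] relpow_chain[where f=f and R=R and n=n, of j n]
        f ij eq by auto
    then have "(a, b) \<in> R ^^ (i + (n - j))" by (auto simp: relpow_add)
    then have "n \<le> i + (n - j)" unfolding n_def by (rule Least_le)
    then show False using ij by linarith
  qed
  then have "inj_on f {..n}" by (intro linorder_inj_onI) auto
  then show ?thesis using that f by blast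
qed

text \<open>The attachments \<open>x 0\<close> and \<open>x (Suc k)\<close> may coincide;
  distinctness is demanded only of the inner vertices and of the edges.\<close>

definition ear :: "('e \<Rightarrow> 'v uprod) \<Rightarrow> 'e set \<Rightarrow> 'v set \<Rightarrow> nat \<Rightarrow> (nat \<Rightarrow> 'v) \<Rightarrow> (nat \<Rightarrow> 'e) \<Rightarrow> bool" where
  "ear en F A k x c \<longleftrightarrow> 1 \<le> k \<and> x 0 \<in> A \<and> x (Suc k) \<in> A \<and> (\<forall>i\<in>{1..k}. x i \<notin> A) \<and> inj_on x {1..k}
     \<and> (\<forall>i\<le>k. c i \<in> F \<and> en (c i) = Upair (x i) (x (Suc i))) \<and> inj_on c {..k}"

text \<open>At least two edges leave the component \<open>K\<close> of \<open>u\<close> outside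
  \<open>A\<close>, and they can only lead to \<open>A\<close>. A shortest chain in \<open>K\<close>
  between their inner ends, possibly of length zero, completes the ear.\<close>

lemma ear_exists:
  assumes u: "u \<in> biconn r en F" "u \<notin> A" and r: "r \<in> A"
  obtains k x c where "ear en F A k x c"
proof -
  define R where "R = {(a, b). a \<notin> A \<and> b \<notin> A \<and> (\<exists>e\<in>F. en e = Upair a b)}"
  have "sym R" unfolding R_def sym_def by (auto simp: Upair_inject) (metis Upair_inject)+
  then have symR: "sym (R\<^sup>*)" by (rule sym_rtrancl)
  define K where "K = {w. (u, w) \<in> R\<^sup>*}"
  have uK: "u \<in> K" by (simp add: K_def)
  have KA: "w \<notin> A" if "w \<in> K" for w
  proof -
    have "(u, w) \<in> R\<^sup>*" using that by (simp add: K_def)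
    then show ?thesis by (cases rule: rtranclE) (use u(2) in \<open>auto simp: R_def\<close>)
  qed
  have step: "b \<in> K" if "a \<in> K" "(a, b) \<in> R" for a b
    using that unfolding K_def by (auto intro: rtrancl_into_rtrancl)
  have "2 \<le> card {e \<in> F. crosses K (en e)}"
    using biconnD[OF u(1) uK] KA r unfolding cut_size_def by blast
  then obtain e e' where ee: "e \<in> F" "crosses K (en e)" "e' \<in> F" "crosses K (en e')" "e \<noteq> e'"
    using card_le_Suc0_iff_eq[of "{e \<in> F. crosses K (en e)}"] card.infinite
    by (metis (no_types, lifting) mem_Collect_eq not_less_eq_eq numeral_2_eq_2 zero_le)
  have out: "\<exists>a b. en e = Upair a b \<and> a \<in> K \<and> b \<in> A" if e: "e \<in> F" "crosses K (en e)" for e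
  proof -
    obtain a b where ab: "en e = Upair a b" "a \<in> K" "b \<notin> K"
      using e(2) by (cases "en e") (auto simp: Upair_inject)
    then have "b \<in> A" using step[of a b] KA[of a] e(1) by (auto simp: R_def)
    then show ?thesis using ab by blast
  qed
  obtain a b where ab: "en e = Upair a b" "a \<in> K" "b \<in> A" using out[OF ee(1,2)] by blast
  obtain a' b' where ab': "en e' = Upair a' b'" "a' \<in> K" "b' \<in> A" using out[OF ee(3,4)] by blast
  have "(a, u) \<in> R\<^sup>*" "(u, a') \<in> R\<^sup>*" using ab ab' symR by (auto simp: K_def dest: symD)
  then have "(a, a') \<in> R\<^sup>*" by (rule rtrancl_trans)
  then obtain f n where f: "f 0 = a" "f n = a'" "\<And>i. i < n \<Longrightarrow> (f i, f (Suc i)) \<in> R" "inj_on f {..n}"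
    by (rule injective_chain_exists) (rule that)
  have fK: "f i \<in> K" if "i \<le> n" for i using that by (induction i) (auto simp: f ab(2) intro: step)
  have "\<exists>g. \<forall>i<n. g i \<in> F \<and> en (g i) = Upair (f i) (f (Suc i))"
    using f(3) unfolding R_def by (intro choice allI) fastforce
  then obtain g where g: "\<And>i. i < n \<Longrightarrow> g i \<in> F \<and> en (g i) = Upair (f i) (f (Suc i))" by blast
  have g_in: "\<not> crosses K (en (g i))" if "i < n" for i using g[OF that] fK that by simp
  have g_inj: "g i \<noteq> g j" if "i < j" "j < n" for i j
  proof
    assume "g i = g j"
    then have "f i = f j \<or> f i = f (Suc j)" using g[of i] g[of j] that by (auto simp: Upair_inject)
    moreover have "i = j" if "f i = f j" using inj_onD[OF f(4) that] \<open>i < j\<close> \<open>j < n\<close> by simp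
    moreover have "i = Suc j" if "f i = f (Suc j)"
      using inj_onD[OF f(4) that] \<open>i < j\<close> \<open>j < n\<close> by simp
    ultimately show False using \<open>i < j\<close> by auto
  qed
  \<comment> \<open>The chain \<open>f 0\<close>, ..., \<open>f n\<close> supplies the inner
    vertices \<open>x 1\<close>, ..., \<open>x (Suc n)\<close>, so the ear has
    \<open>k = Suc n\<close>.\<close>
  define x where "x = (\<lambda>i. if i = 0 then b else if i \<le> Suc n then f (i - 1) else b')"
  define c where "c = (\<lambda>i. if i = 0 then e else if i \<le> n then g (i - 1) else e')"
  have "inj_on c {..Suc n}"
  proof (rule linorder_inj_onI)
    fix i j assume ij: "i < j" "i \<in> {..Suc n}" "j \<in> {..Suc n}"
    consider "i = 0" "j = Suc n" | "i = 0" "j \<le> n" | "i \<noteq> 0" "j = Suc n" | "i \<noteq> 0" "j \<le> n"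
      using ij by force
    then show "c i \<noteq> c j"
    proof cases
      case 1
      then show ?thesis using ee by (simp add: c_def)
    next
      case 2
      then have "c i = e" "c j = g (j - 1)" "j - 1 < n" using ij by (auto simp: c_def)
      then show ?thesis using g_in ee by metis
    next
      case 3
      then have "c j = e'" "c i = g (i - 1)" "i - 1 < n" using ij by (auto simp: c_def)
      then show ?thesis using g_in ee by metis
    next
      case 4
      then have "c j = g (j - 1)" "c i = g (i - 1)" "i - 1 < j - 1" "j - 1 < n" using ij by (auto simp: c_def)
      then show ?thesis using g_inj by metis
    qed
  qed auto
  moreover have "c i \<in> F \<and> en (c i) = Upair (x i) (x (Suc i))" if "i \<le> Suc n" for i
  proof -
    have "i = 0 \<or> i \<noteq> 0 \<and> i \<le> n \<or> i = Suc n" using that by auto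
    then consider "i = 0" | "i \<noteq> 0" "i \<le> n" | "i = Suc n" by blast
    then show ?thesis
    proof cases
      case 2
      then obtain i' where "i = Suc i'" "i' < n" by (cases i) auto
      then show ?thesis using g[of i'] by (simp add: c_def x_def)
    qed (use ab ab' ee f in \<open>auto simp: c_def x_def Upair_inject\<close>)
  qed
  moreover have x: "x i = f (i - 1)" "i - 1 \<le> n" if "i \<in> {1..Suc n}" for i
    using that by (auto simp: x_def)
  have "inj_on x {1..Suc n}"
  proof (rule inj_onI)
    fix i j assume ij: "i \<in> {1..Suc n}" "j \<in> {1..Suc n}" "x i = x j"
    then have "i - 1 = j - 1" using x inj_onD[OF f(4), of "i - 1" "j - 1"] by simp
    then show "i = j" using ij by auto
  qed
  moreover have "x i \<notin> A" if "i \<in> {1..Suc n}" for i using x[OF that] fK KA by simp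
  ultimately have "ear en F A (Suc n) x c"
    using ab ab' by (auto simp: ear_def x_def)
  then show ?thesis by (rule that)
qed

lemma ear_reverse:
  assumes "ear en F A k x c"
  shows "ear en F A k (\<lambda>i. x (Suc k - i)) (\<lambda>i. c (k - i))"
proof -
  from assms have e: "1 \<le> k" "x 0 \<in> A" "x (Suc k) \<in> A" "inj_on x {1..k}" "inj_on c {..k}"
    "\<And>i. i \<le> k \<Longrightarrow> c i \<in> F \<and> en (c i) = Upair (x i) (x (Suc i))"
    "\<And>i. i \<in> {1..k} \<Longrightarrow> x i \<notin> A"
    unfolding ear_def by blast+
  have "inj_on (\<lambda>i. x (Suc k - i)) {1..k}"
  proof (rule inj_onI)
    fix i j assume ij: "i \<in> {1..k}" "j \<in> {1..k}" "x (Suc k - i) = x (Suc k - j)"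
    then have "Suc k - i = Suc k - j" by (intro inj_onD[OF e(4) ij(3)]) auto
    then show "i = j" using ij by auto
  qed
  moreover have "inj_on (\<lambda>i. c (k - i)) {..k}"
  proof (rule inj_onI)
    fix i j assume ij: "i \<in> {..k}" "j \<in> {..k}" "c (k - i) = c (k - j)"
    then have "k - i = k - j" by (intro inj_onD[OF e(5) ij(3)]) auto
    then show "i = j" using ij by auto
  qed
  moreover have "c (k - i) \<in> F \<and> en (c (k - i)) = Upair (x (Suc k - i)) (x (Suc k - Suc i))" if "i \<le> k" for i
    using e(6)[of "k - i"] that by (auto simp: Suc_diff_le Upair_inject)
  moreover have "x (Suc k - i) \<notin> A" if "i \<in> {1..k}" for i
    by (rule e(7)) (use that in auto)
  ultimately show ?thesis using e(1-3) unfolding ear_def by auto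
qed

section \<open>Interval numberings grown along ears\<close>

text \<open>
  The parents \<open>\<pi> v\<close> and \<open>\<rho> v\<close> of \<open>v\<close> in the two trees are reached along \<open>P v\<close> and \<open>Q v\<close>. Towards the
  root \<open>lo\<close> decreases along the first tree and \<open>hi\<close> increases along the second one; \<open>a v\<close> bounds
  the positions in \<open>es\<close> of all edges used from \<open>v\<close>.
\<close>

definition numbering where
  "numbering r en es A P Q \<pi> \<rho> (lo :: 'v \<Rightarrow> rat) hi a \<longleftrightarrow>
     r \<in> A \<and> lo r < hi r \<and> a r = 0
     \<and> (\<forall>v\<in>A - {r}. \<pi> v \<in> A \<and> en (P v) = Upair v (\<pi> v) \<and> lo (\<pi> v) < lo v
          \<and> a (\<pi> v) \<le> a v \<and> P v \<in> set (take (a v) es))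
     \<and> (\<forall>v\<in>A - {r}. \<rho> v \<in> A \<and> en (Q v) = Upair v (\<rho> v) \<and> hi v < hi (\<rho> v)
          \<and> a (\<rho> v) \<le> a v \<and> Q v \<in> set (take (a v) es))
     \<and> (\<forall>v\<in>A - {r}. lo v < hi v)
     \<and> (\<forall>u\<in>A - {r}. \<forall>w\<in>A - {r}. P u = Q w \<longrightarrow> hi w \<le> lo u)"

text \<open>The first tree runs backwards along the ear and the second forwards. The edge
  \<open>c i\<close> between inner vertices is used by \<open>x (Suc i)\<close> in the first tree
  and by \<open>x i\<close> in the second, whose intervals just touch. Old values stay
  unchanged.\<close>

lemma numbering_extend:
  fixes x :: "nat \<Rightarrow> 'v" and c :: "nat \<Rightarrow> 'e"
  assumes num: "numbering r en es A P Q \<pi> \<rho> lo hi a" and bound: "\<forall>v\<in>A. a v \<le> n"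
    and ear: "ear en (set (take n es)) A k x c" and less: "lo (x 0) < hi (x (Suc k))"
  obtains P' Q' \<pi>' \<rho>' lo' hi' a' where
    "numbering r en es (A \<union> x ` {1..k}) P' Q' \<pi>' \<rho>' lo' hi' a'"
    "\<And>v. v \<in> A \<Longrightarrow> a' v = a v" "\<And>v. v \<in> x ` {1..k} \<Longrightarrow> a' v = n"
proof -
  from ear have e: "x 0 \<in> A" "x (Suc k) \<in> A" "inj_on x {1..k}" "inj_on c {..k}"
    and ec: "\<And>i. i \<le> k \<Longrightarrow> c i \<in> set (take n es)" "\<And>i. i \<le> k \<Longrightarrow> en (c i) = Upair (x i) (x (Suc i))"
    and new: "\<And>i. i \<in> {1..k} \<Longrightarrow> x i \<notin> A"
    unfolding ear_def by blast+
  let ?L = "lo (x 0)" and ?H = "hi (x (Suc k))"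
  \<comment> \<open>The inner vertex \<open>x i\<close> receives the interval from
    \<open>t i\<close> to \<open>t (Suc i)\<close>. Only \<open>t (k + 2)\<close> reaches the value
    \<open>hi (x (Suc k))\<close>, because the upper end at \<open>x k\<close> is
    \<open>t (k + 1)\<close> and must lie strictly below.\<close>
  define t :: "nat \<Rightarrow> rat" where "t i = ?L + (?H - ?L) * of_nat i / of_nat (k + 2)" for i
  have t0: "t 0 = ?L" and tk: "t (k + 2) = ?H" by (simp_all add: t_def del: of_nat_add)
  have t_mono: "t i < t j \<longleftrightarrow> i < j" for i j
    using less by (simp add: t_def divide_less_cancel mult_less_cancel_left_pos)
  define idx where "idx = inv_into {1..k} x"
  have idx [simp]: "idx (x i) = i" if "i \<in> {1..k}" for i
    using e(3) that by (simp add: idx_def)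
  define P' where "P' = (\<lambda>v. if v \<in> A then P v else c (idx v - 1))"
  define Q' where "Q' = (\<lambda>v. if v \<in> A then Q v else c (idx v))"
  define \<pi>' where "\<pi>' = (\<lambda>v. if v \<in> A then \<pi> v else x (idx v - 1))"
  define \<rho>' where "\<rho>' = (\<lambda>v. if v \<in> A then \<rho> v else x (Suc (idx v)))"
  define lo' where "lo' = (\<lambda>v. if v \<in> A then lo v else t (idx v))"
  define hi' where "hi' = (\<lambda>v. if v \<in> A then hi v else t (Suc (idx v)))"
  define a' where "a' = (\<lambda>v. if v \<in> A then a v else n)"
  note defs = P'_def Q'_def \<pi>'_def \<rho>'_def lo'_def hi'_def a'_def
  let ?B = "A \<union> x ` {1..k}"
  note N = num[unfolded numbering_def]
  have cases_B: "v \<in> A - {r} \<or> (\<exists>i\<in>{1..k}. v = x i)" if "v \<in> ?B - {r}" for v using that by blast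
  have xB: "x i \<in> ?B" if "i \<le> Suc k" for i
    using that e(1,2) by (cases "i = 0 \<or> i = Suc k") auto
  have ab: "a' v \<le> n" for v using bound by (simp add: a'_def)
  have lo_x: "lo' (x i) = t i" if "i \<le> k" for i
    using that e(1) new t0 by (cases "i = 0") (auto simp: lo'_def)
  have hi_x: "hi' (x i) = t (Suc i)" if "1 \<le> i" "i \<le> Suc k" for i
    using that e(2) new tk by (cases "i = Suc k") (auto simp: hi'_def)
  have old: "P' v = P v" "Q' v = Q v" "\<pi>' v = \<pi> v" "\<rho>' v = \<rho> v" "lo' v = lo v" "hi' v = hi v" "a' v = a v"
    if "v \<in> A" for v using that by (simp_all add: defs)
  have fresh: "P' (x i) = c (i - 1)" "Q' (x i) = c i" "\<pi>' (x i) = x (i - 1)" "\<rho>' (x i) = x (Suc i)" "a' (x i) = n"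
    if "i \<in> {1..k}" for i using that new[OF that] by (simp_all add: defs)
  \<comment> \<open>Every ear edge has an inner and hence new end, while an old tree edge has both
    ends in \<open>A\<close>.\<close>
  have old_edge: "P v \<noteq> c i" "Q v \<noteq> c i" if v: "v \<in> A - {r}" and i: "i \<le> k" for v i
  proof -
    have "x i \<notin> A \<or> x (Suc i) \<notin> A"
      using new[of i] new[of "Suc i"] i ear by (cases "i = 0") (auto simp: ear_def)
    moreover have "en (P v) = Upair v (\<pi> v)" "\<pi> v \<in> A" "en (Q v) = Upair v (\<rho> v)" "\<rho> v \<in> A"
      using N v by blast+
    ultimately show "P v \<noteq> c i" "Q v \<noteq> c i" using ec(2)[OF i] v by (auto simp: Upair_inject)
  qed
  have P: "\<pi>' v \<in> ?B \<and> en (P' v) = Upair v (\<pi>' v) \<and> lo' (\<pi>' v) < lo' v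
      \<and> a' (\<pi>' v) \<le> a' v \<and> P' v \<in> set (take (a' v) es)" if "v \<in> ?B - {r}" for v
    using cases_B[OF that]
  proof (elim disjE bexE)
    assume v: "v \<in> A - {r}"
    then have "\<pi> v \<in> A \<and> en (P v) = Upair v (\<pi> v) \<and> lo (\<pi> v) < lo v
      \<and> a (\<pi> v) \<le> a v \<and> P v \<in> set (take (a v) es)" using N by blast
    then show ?thesis using v by (simp add: old)
  next
    fix i assume i: "i \<in> {1..k}" "v = x i"
    then obtain j where j: "i = Suc j" by (cases i) auto
    then have "en (c j) = Upair v (x j)" using i ec(2)[of j] by (auto simp: Upair_inject)
    then show ?thesis
      using i j fresh[OF i(1)] xB[of j] ec(1)[of j] lo_x[of j] lo_x[of i] ab
      by (simp add: t_mono)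
  qed
  have Q: "\<rho>' v \<in> ?B \<and> en (Q' v) = Upair v (\<rho>' v) \<and> hi' v < hi' (\<rho>' v)
      \<and> a' (\<rho>' v) \<le> a' v \<and> Q' v \<in> set (take (a' v) es)" if "v \<in> ?B - {r}" for v
    using cases_B[OF that]
  proof (elim disjE bexE)
    assume v: "v \<in> A - {r}"
    then have "\<rho> v \<in> A \<and> en (Q v) = Upair v (\<rho> v) \<and> hi v < hi (\<rho> v)
      \<and> a (\<rho> v) \<le> a v \<and> Q v \<in> set (take (a v) es)" using N by blast
    then show ?thesis using v by (simp add: old)
  next
    fix i assume i: "i \<in> {1..k}" "v = x i"
    then show ?thesis
      using fresh[OF i(1)] xB[of "Suc i"] ec[of i] hi_x[of i] hi_x[of "Suc i"] ab
      by (simp add: t_mono)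
  qed
  have "lo' v < hi' v" if "v \<in> ?B - {r}" for v
    using cases_B[OF that]
  proof (elim disjE bexE)
    assume "v \<in> A - {r}"
    then show ?thesis using N old by simp
  next
    fix i assume "i \<in> {1..k}" "v = x i"
    then show ?thesis using lo_x[of i] hi_x[of i] by (simp add: t_mono)
  qed
  moreover have "hi' w \<le> lo' u" if "u \<in> ?B - {r}" "w \<in> ?B - {r}" and eq: "P' u = Q' w" for u w
    using cases_B[OF that(1)] cases_B[OF that(2)]
  proof (elim disjE bexE)
    assume "u \<in> A - {r}" "w \<in> A - {r}"
    moreover from this have "P u = Q w" using eq old(1)[of u] old(2)[of w] by simp
    ultimately have "hi w \<le> lo u" using N by blast
    then show ?thesis using \<open>u \<in> A - {r}\<close> \<open>w \<in> A - {r}\<close> old(5)[of u] old(6)[of w] by simp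
  next
    fix i assume "i \<in> {1..k}" "w = x i" "u \<in> A - {r}"
    then show ?thesis using eq old(1)[of u] fresh(2)[of i] old_edge(1)[of u i] by simp
  next
    fix i assume "i \<in> {1..k}" "u = x i" "w \<in> A - {r}"
    then have "Q w = c (i - 1)" using eq old(2)[of w] fresh(1)[of i] by simp
    moreover have "i - 1 \<le> k" using \<open>i \<in> {1..k}\<close> by auto
    ultimately show ?thesis using old_edge(2)[OF \<open>w \<in> A - {r}\<close>, of "i - 1"] by simp
  next
    fix i j assume ij: "i \<in> {1..k}" "u = x i" "j \<in> {1..k}" "w = x j"
    then have "c (i - 1) = c j" using eq fresh by simp
    then have "i - 1 = j" using ij by (intro inj_onD[OF e(4)]) auto
    then have "i = Suc j" using ij(1) by auto
    then show ?thesis using ij lo_x[of i] hi_x[of j] by simp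
  qed
  moreover have "r \<in> ?B" "lo' r < hi' r" "a' r = 0" using N old by auto
  ultimately have num': "numbering r en es ?B P' Q' \<pi>' \<rho>' lo' hi' a'"
    unfolding numbering_def using P Q by simp
  have "a' v = n" if "v \<in> x ` {1..k}" for v using that fresh(5) by blast
  from that[OF num' old(7) this] show ?thesis .
qed

text \<open>The prefix of length \<open>n\<close> may still be under treatment: its vertices may
  already be present, but only shorter prefixes are known to be exhausted.\<close>

definition progress where
  "progress r en V es n A \<longleftrightarrow> A \<subseteq> V \<and>
     (\<exists>P Q \<pi> \<rho> lo hi a. numbering r en es A P Q \<pi> \<rho> lo hi a \<and> (\<forall>v\<in>A. a v \<le> n)
        \<and> (\<forall>m<n. \<forall>v\<in>V \<inter> biconn r en (set (take m es)). v \<in> A \<and> a v \<le> m))"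

lemma progress_step:
  assumes prog: "progress r en V es n A" and u: "u \<in> biconn r en (set (take n es))" "u \<notin> A"
    and wf: "\<And>e. e \<in> set es \<Longrightarrow> set_uprod (en e) \<subseteq> V"
  obtains B where "A \<subset> B" "progress r en V es n B"
proof -
  from prog obtain P Q \<pi> \<rho> lo hi a where
    num: "numbering r en es A P Q \<pi> \<rho> lo hi a" and AV: "A \<subseteq> V" and bound: "\<forall>v\<in>A. a v \<le> n"
    and early: "\<And>m v. m < n \<Longrightarrow> v \<in> V \<inter> biconn r en (set (take m es)) \<Longrightarrow> v \<in> A \<and> a v \<le> m"
    unfolding progress_def by blast
  have r: "r \<in> A" using num by (simp add: numbering_def)
  have lohi: "lo v < hi v" if "v \<in> A" for v using that num unfolding numbering_def by (cases "v = r") auto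
  obtain k x c where ear0: "ear en (set (take n es)) A k x c" using ear_exists[OF u r] .
  obtain x c where ear: "ear en (set (take n es)) A k x c" and less: "lo (x 0) < hi (x (Suc k))"
  proof (cases "lo (x 0) < hi (x (Suc k))")
    case True
    then show ?thesis using that ear0 by blast
  next
    case False
    have "x 0 \<in> A" "x (Suc k) \<in> A" using ear0 by (auto simp: ear_def)
    \<comment> \<open>\<open>lo\<close> is below \<open>hi\<close> at both attachments, so an ear
      that does not fit in one direction fits in the other.\<close>
    then have "lo (x (Suc k)) < hi (x 0)" using lohi[of "x 0"] lohi[of "x (Suc k)"] False by simp
    then show ?thesis using that[OF ear_reverse[OF ear0]] by simp
  qed
  obtain P' Q' \<pi>' \<rho>' lo' hi' a' where
    *: "numbering r en es (A \<union> x ` {1..k}) P' Q' \<pi>' \<rho>' lo' hi' a'"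
    and a': "\<And>v. v \<in> A \<Longrightarrow> a' v = a v" "\<And>v. v \<in> x ` {1..k} \<Longrightarrow> a' v = n"
    by (rule numbering_extend[OF num bound ear less]) (rule that)
  have new: "1 \<le> k" "\<And>i. i \<in> {1..k} \<Longrightarrow> x i \<notin> A"
    and ec: "\<And>i. i \<le> k \<Longrightarrow> c i \<in> set (take n es) \<and> en (c i) = Upair (x i) (x (Suc i))"
    using ear unfolding ear_def by blast+
  have "x i \<in> V" if "i \<in> {1..k}" for i
  proof -
    have "c i \<in> set es" "x i \<in> set_uprod (en (c i))" using ec[of i] that by (auto dest: in_set_takeD)
    then show ?thesis using wf by blast
  qed
  then have "A \<union> x ` {1..k} \<subseteq> V" using AV by blast
  moreover have "\<forall>v\<in>A \<union> x ` {1..k}. a' v \<le> n" using a' bound by auto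
  moreover have "v \<in> A \<union> x ` {1..k} \<and> a' v \<le> m" if "m < n" "v \<in> V \<inter> biconn r en (set (take m es))" for m v
    using early[OF that] a'(1) by simp
  ultimately have "progress r en V es n (A \<union> x ` {1..k})"
    unfolding progress_def using * by blast
  moreover have "A \<subset> A \<union> x ` {1..k}" using new(1) new(2)[of 1] by auto
  ultimately show ?thesis using that by blast
qed

lemma progress_saturate:
  assumes "finite V" "progress r en V es n A" and wf: "\<And>e. e \<in> set es \<Longrightarrow> set_uprod (en e) \<subseteq> V"
  obtains B where "progress r en V es (Suc n) B"
proof -
  have "\<exists>B. progress r en V es n B \<and> V \<inter> biconn r en (set (take n es)) \<subseteq> B"
    using assms(2)
  proof (induction "card (V - A)" arbitrary: A rule: less_induct)
    case less
    show ?case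
    proof (cases "V \<inter> biconn r en (set (take n es)) \<subseteq> A")
      case False
      then obtain u where u: "u \<in> biconn r en (set (take n es))" "u \<notin> A" by blast
      obtain B where B: "A \<subset> B" "progress r en V es n B" using progress_step[OF less(2) u wf] .
      have "B \<subseteq> V" using B(2) by (simp add: progress_def)
      then have "V - B \<subset> V - A" using B(1) by blast
      then have "card (V - B) < card (V - A)" using assms(1) by (intro psubset_card_mono) auto
      then show ?thesis using less(1) B(2) by blast
    qed (use less in blast)
  qed
  then obtain B where B: "progress r en V es n B" "V \<inter> biconn r en (set (take n es)) \<subseteq> B" by blast
  from B(1) obtain P Q \<pi> \<rho> lo hi a where
    num: "numbering r en es B P Q \<pi> \<rho> lo hi a" "B \<subseteq> V" "\<forall>v\<in>B. a v \<le> n"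
      "\<And>m v. m < n \<Longrightarrow> v \<in> V \<inter> biconn r en (set (take m es)) \<Longrightarrow> v \<in> B \<and> a v \<le> m"
    unfolding progress_def by blast
  have "v \<in> B \<and> a v \<le> m" if "m < Suc n" "v \<in> V \<inter> biconn r en (set (take m es))" for m v
  proof (cases "m = n")
    case True
    then show ?thesis using num(3) B(2) that(2) by blast
  next
    case False
    then show ?thesis using num(4)[OF _ that(2)] that(1) by simp
  qed
  moreover have "\<forall>v\<in>B. a v \<le> Suc n" using num(3) by auto
  ultimately have "progress r en V es (Suc n) B" unfolding progress_def using num(1,2) by blast
  then show ?thesis by (rule that)
qed

lemma progress_exists:
  assumes "finite V" "r \<in> V" and wf: "\<And>e. e \<in> set es \<Longrightarrow> set_uprod (en e) \<subseteq> V"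
  shows "\<exists>A. progress r en V es n A"
proof (induction n)
  case 0
  have "numbering r en es {r} P Q \<pi> \<rho> (\<lambda>_. 0) (\<lambda>_. 1) (\<lambda>_. 0)" for P Q \<pi> \<rho>
    by (simp add: numbering_def)
  then show ?case unfolding progress_def using assms(2) by (intro exI[of _ "{r}"]) fastforce
next
  case (Suc n)
  then obtain A where "progress r en V es n A" by blast
  then obtain B where "progress r en V es (Suc n) B" by (rule progress_saturate[OF assms(1) _ wf])
  then show ?case by blast
qed

section \<open>From a numbering to two trees\<close>

lemma two_trees:
  fixes G :: "('v, 'e) multigraph"
  assumes G: "finite_multigraph G" "r \<in> verts G" and es: "set es = edges G"
    and val: "valid r (ends G) (verts G) es"
  obtains T1 T2 where "spanning_tree T1 G" "spanning_tree T2 G"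
    "\<And>v p q. path T1 r p v \<Longrightarrow> path T2 r q v \<Longrightarrow> walk_edges p \<inter> walk_edges q = {}"
    "\<And>v p as bs. path T1 r p v \<or> path T2 r p v \<Longrightarrow> es = as @ bs \<Longrightarrow>
       v \<in> biconn r (ends G) (set as) \<Longrightarrow> walk_edges p \<subseteq> set as"
proof -
  have fin: "finite (verts G)" and wf: "\<And>e. e \<in> set es \<Longrightarrow> set_uprod (ends G e) \<subseteq> verts G"
    using G(1) es by (auto simp: finite_multigraph_def wf_multigraph_def)
  \<comment> \<open>\<open>Suc\<close> because \<open>progress\<close> exhausts only prefixes
    shorter than its index, and the whole list has to be included.\<close>
  obtain A where "progress r (ends G) (verts G) es (Suc (length es)) A"
    using progress_exists[where en="ends G", OF fin G(2) wf] by blast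
  then obtain P Q \<pi> \<rho> lo hi a where num: "numbering r (ends G) es A P Q \<pi> \<rho> lo hi a"
    and AV: "A \<subseteq> verts G" and bound: "\<And>m v. m \<le> length es \<Longrightarrow>
       v \<in> verts G \<inter> biconn r (ends G) (set (take m es)) \<Longrightarrow> v \<in> A \<and> a v \<le> m"
    unfolding progress_def by (metis le_imp_less_Suc)
  have bound': "v \<in> A \<and> a v \<le> length as"
    if "v \<in> verts G" "es = as @ bs" "v \<in> biconn r (ends G) (set as)" for v as bs
    using bound[of "length as" v] that by simp
  have "verts G \<subseteq> A" using val bound' unfolding valid_def by blast
  with AV have A: "A = verts G" by blast
  note N = num[unfolded numbering_def A]
  interpret T1: parent_tree "verts G" r "ends G" P \<pi> lo
    using fin N by unfold_locales blast+
  \<comment> \<open>Towards the root \<open>hi\<close> increases in the second tree, hence the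
    sign.\<close>
  interpret T2: parent_tree "verts G" r "ends G" Q \<rho> "\<lambda>v. - hi v"
    using fin N by unfold_locales (blast | simp)+
  have "P ` (verts G - {r}) \<subseteq> edges G" "Q ` (verts G - {r}) \<subseteq> edges G"
    using N es by (auto dest!: in_set_takeD)
  then have st: "spanning_tree T1.T G" "spanning_tree T2.T G"
    using T1.tree_T T2.tree_T T1.wf_T T2.wf_T
    by (auto simp: spanning_tree_def subtree_def subgraph_def)
  have up1: "lo w \<le> lo v \<and> a w \<le> a v" if "(v, w) \<in> T1.up\<^sup>*" for v w
    using that
  proof (induction rule: rtrancl_induct)
    case (step x y)
    then have "x \<in> verts G - {r}" "y = \<pi> x" by (auto simp: T1.up_def)
    then have "lo y < lo x" "a y \<le> a x" using N by blast+
    then show ?case using step by simp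
  qed simp
  have up2: "hi v \<le> hi w \<and> a w \<le> a v" if "(v, w) \<in> T2.up\<^sup>*" for v w
    using that
  proof (induction rule: rtrancl_induct)
    case (step x y)
    then have "x \<in> verts G - {r}" "y = \<rho> x" by (auto simp: T2.up_def)
    then have "hi x < hi y" "a y \<le> a x" using N by blast+
    then show ?case using step by simp
  qed simp
  show ?thesis
  proof (rule that[OF st])
    fix v p q assume pq: "path T1.T r p v" "path T2.T r q v"
    have v: "v \<in> verts G" using pq(1) walk_end[of T1.T r p v] by (simp add: path_def)
    show "walk_edges p \<inter> walk_edges q = {}"
    proof (rule ccontr)
      assume "\<not> ?thesis"
      then obtain e where e: "e \<in> walk_edges p" "e \<in> walk_edges q" by blast
      obtain u where u: "u \<in> verts G" "u \<noteq> r" "(v, u) \<in> T1.up\<^sup>*" "e = P u"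
        using T1.path_from_root_edges[OF pq(1) e(1)] .
      obtain w where w: "w \<in> verts G" "w \<noteq> r" "(v, w) \<in> T2.up\<^sup>*" "e = Q w"
        using T2.path_from_root_edges[OF pq(2) e(2)] .
      \<comment> \<open>A common edge would give
        \<open>hi w \<le> lo u \<le> lo v < hi v \<le> hi w\<close>.\<close>
      have "hi w \<le> lo u" using N u w by auto
      moreover have "lo v < hi v" using N v by (cases "v = r") auto
      ultimately show False using up1[OF u(3)] up2[OF w(3)] by simp
    qed
  next
    fix v p as bs
    assume p: "path T1.T r p v \<or> path T2.T r p v" and split: "es = as @ bs" "v \<in> biconn r (ends G) (set as)"
    have v: "v \<in> verts G"
      using p walk_end[of T1.T r p v] walk_end[of T2.T r p v] by (auto simp: path_def)
    have av: "a v \<le> length as" using bound'[OF v split] by blast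
    have "\<exists>w. e \<in> set (take (a w) es) \<and> a w \<le> a v" if e: "e \<in> walk_edges p" for e
      using p
    proof
      assume "path T1.T r p v"
      from T1.path_from_root_edges[OF this e] obtain w where
        w: "w \<in> verts G" "w \<noteq> r" "(v, w) \<in> T1.up\<^sup>*" "e = P w" .
      then have "e \<in> set (take (a w) es)" using N by blast
      then show ?thesis using up1[OF w(3)] by blast
    next
      assume "path T2.T r p v"
      from T2.path_from_root_edges[OF this e] obtain w where
        w: "w \<in> verts G" "w \<noteq> r" "(v, w) \<in> T2.up\<^sup>*" "e = Q w" .
      then have "e \<in> set (take (a w) es)" using N by blast
      then show ?thesis using up2[OF w(3)] by blast
    qed
    moreover have "set (take (a w) es) \<subseteq> set as" if "a w \<le> a v" for w
      using set_take_subset_set_take[of "a w" "length as" es] that av split(1) by simp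
    ultimately show "walk_edges p \<subseteq> set as" by blast
  qed
qed

section \<open>Four independent trees\<close>

lemma walk_crosses:
  assumes "walk G u p v" "u \<in> X" "v \<notin> X"
  shows "\<exists>e\<in>edges G. crosses X (ends G e)"
  using assms
proof (induction G u p v rule: walk.induct)
  case (2 G u e w p v)
  then have e: "e \<in> edges G" "ends G e = Upair u w" by simp_all
  show ?case
  proof (cases "w \<in> X")
    case False
    then show ?thesis using e 2(3) by (intro bexI[of _ e]) simp_all
  qed (use 2 in simp)
qed simp

lemma edge_connected_imp_four_connected:
  assumes "finite_multigraph G" "edge_connected 4 G"
  shows "four_connected (verts G) (edges G) (ends G)"
  unfolding four_connected_def
proof (intro allI impI, rule ccontr)
  fix X assume X: "X \<subset> verts G" "X \<noteq> {}" and "\<not> 4 \<le> cut_size (ends G) (edges G) X"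
  define F where "F = {e \<in> edges G. crosses X (ends G e)}"
  have "F \<subseteq> edges G" "finite F" "card F < 4"
    using assms(1) \<open>\<not> 4 \<le> _\<close> by (auto simp: F_def finite_multigraph_def cut_size_def)
  then have "connected (delete_edges G F)" using assms(2) by (simp add: edge_connected_def)
  moreover obtain u v where uv: "u \<in> X" "u \<in> verts G" "v \<notin> X" "v \<in> verts G" using X by blast
  moreover have "verts (delete_edges G F) = verts G" by (simp add: delete_edges_def)
  ultimately obtain p where "path (delete_edges G F) u p v" unfolding connected_def by metis
  then have "walk (delete_edges G F) u p v" by (simp add: path_def)
  from walk_crosses[OF this uv(1,3)] show False by (auto simp: delete_edges_def F_def)
qed

lemma edge_independentI:
  assumes "spanning_tree T1 G" "spanning_tree T2 G" "r \<in> verts G"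
    and "\<And>v p q. v \<in> verts G \<Longrightarrow> path T1 r p v \<Longrightarrow> path T2 r q v \<Longrightarrow> walk_edges p \<inter> walk_edges q = {}"
  shows "edge_independent G r T1 T2"
  using assms by (auto simp: edge_independent_def spanning_tree_def)

lemma edge_independent_sym: "edge_independent G r T1 T2 \<Longrightarrow> edge_independent G r T2 T1"
  by (auto simp: edge_independent_def)

text \<open>This makes the four trees distinct, as \<open>pairwise\<close> says nothing about equal
  members and the set must have exactly four.\<close>

lemma edge_independent_irrefl:
  assumes "spanning_tree T G" "r \<in> verts G" "card (verts G) > 1"
  shows "\<not> edge_independent G r T T"
proof
  assume ind: "edge_independent G r T T"
  have T: "connected T" "verts T = verts G"
    using assms(1) by (auto simp: spanning_tree_def subtree_def tree_def)
  have "\<not> verts G \<subseteq> {r}" using assms(3) card_mono[of "{r}" "verts G"] by auto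
  then obtain v where v: "v \<in> verts G" "v \<noteq> r" by blast
  then obtain p where p: "path T r p v" using T assms(2) unfolding connected_def by blast
  then have "walk_edges p \<inter> walk_edges p = {}"
    using ind v(1) T(2) unfolding edge_independent_def by blast
  then have "p = []" by (simp add: walk_edges_def)
  then show False using p v(2) by (simp add: path_def)
qed

theorem theorem1:
  fixes G :: "('v, 'e) multigraph" and r :: 'v
  assumes "finite_multigraph G"
    and "edge_connected 4 G"
    and "r \<in> verts G"
  shows "\<exists>\<T>. card \<T> = 4 \<and> (\<forall>T \<in> \<T>. spanning_tree T G) \<and> edge_independent_set G r \<T>"
proof -
  let ?V = "verts G" and ?en = "ends G"
  have "finite ?V" "finite (edges G)" "\<And>e. e \<in> edges G \<Longrightarrow> set_uprod (?en e) \<subseteq> ?V"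
    using assms(1) by (auto simp: finite_multigraph_def wf_multigraph_def)
  then obtain es where es: "distinct es" "set es = edges G" and val: "valid r ?en ?V es"
    by (rule valid_list_exists[OF _ _ _ assms(3) edge_connected_imp_four_connected[OF assms(1,2)]])
  have rev_es: "set (rev es) = edges G" using es(2) by simp
  have rev_val: "valid r ?en ?V (rev es)"
    unfolding valid_def
  proof
    fix u assume "u \<in> ?V"
    then obtain as bs where "es = as @ bs" "u \<in> biconn r ?en (set as)" "u \<in> biconn r ?en (set bs)"
      using val unfolding valid_def by blast
    then show "\<exists>as bs. rev es = as @ bs \<and> u \<in> biconn r ?en (set as) \<and> u \<in> biconn r ?en (set bs)"
      by (intro exI[of _ "rev bs"] exI[of _ "rev as"]) simp
  qed
  obtain T1 T2 where T12: "spanning_tree T1 G" "spanning_tree T2 G"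
    "\<And>v p q. path T1 r p v \<Longrightarrow> path T2 r q v \<Longrightarrow> walk_edges p \<inter> walk_edges q = {}"
    and low: "\<And>v p as bs. path T1 r p v \<or> path T2 r p v \<Longrightarrow> es = as @ bs \<Longrightarrow>
       v \<in> biconn r ?en (set as) \<Longrightarrow> walk_edges p \<subseteq> set as"
    by (rule two_trees[OF assms(1,3) es(2) val]) (rule that)
  obtain T3 T4 where T34: "spanning_tree T3 G" "spanning_tree T4 G"
    "\<And>v p q. path T3 r p v \<Longrightarrow> path T4 r q v \<Longrightarrow> walk_edges p \<inter> walk_edges q = {}"
    and high: "\<And>v p as bs. path T3 r p v \<or> path T4 r p v \<Longrightarrow> rev es = as @ bs \<Longrightarrow>
       v \<in> biconn r ?en (set as) \<Longrightarrow> walk_edges p \<subseteq> set as"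
    by (rule two_trees[OF assms(1,3) rev_es rev_val]) (rule that)
  have disj: "walk_edges p \<inter> walk_edges q = {}"
    if v: "v \<in> ?V" and p: "path T1 r p v \<or> path T2 r p v" and q: "path T3 r q v \<or> path T4 r q v"
    for v p q
  proof -
    obtain as bs where ab: "es = as @ bs" "v \<in> biconn r ?en (set as)" "v \<in> biconn r ?en (set bs)"
      using val v unfolding valid_def by blast
    have "walk_edges p \<subseteq> set as" using low[OF p ab(1,2)] .
    moreover have "walk_edges q \<subseteq> set bs" using high[OF q, of "rev bs" "rev as"] ab by simp
    moreover have "set as \<inter> set bs = {}" using es(1) ab(1) by simp
    ultimately show ?thesis by blast
  qed
  have ind: "edge_independent G r T1 T2" "edge_independent G r T3 T4" "edge_independent G r T1 T3"
    "edge_independent G r T1 T4" "edge_independent G r T2 T3" "edge_independent G r T2 T4"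
    using T12 T34 assms(3) disj by (simp_all add: edge_independentI)
  have "card ?V > 1" using assms(2) by (simp add: edge_connected_def)
  note irrefl = edge_independent_irrefl[OF _ assms(3) this]
  have "distinct [T1, T2, T3, T4]" using ind irrefl T12(1,2) T34(1,2) by auto
  then have "card {T1, T2, T3, T4} = 4" by simp
  moreover have "edge_independent_set G r {T1, T2, T3, T4}"
    unfolding edge_independent_set_def
    by (auto simp: pairwise_insert ind ind[THEN edge_independent_sym])
  ultimately show ?thesis using T12(1,2) T34(1,2) by (intro exI[of _ "{T1, T2, T3, T4}"]) simp
qed

end
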